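(* Consider dynamical systems with double recursion of the form $\mathfrak{F} = (\mathbb{F}_q, F, 0, 1)$, where $\mathbb{F}_q$ is a finite field, $F \in \mathbb{F}_q[x,y]$ is a polynomial (acting through its associated polynomial function $\mathbb{F}_q \times \mathbb{F}_q \to \mathbb{F}_q$), and $0, 1$ are the zero and the unit of $\mathbb{F}_q$. It is undecidable, given such an $\mathfrak{F}$, whether $\mathfrak{F}$ is ultimately zero. Moreover, this question remains undecidable if the inputs are simultaneously restricted to the prime fields $\mathbb{F}_p$ ($p$ prime) and to symmetric polynomials $F \in \mathbb{F}_p[x,y]$, i.e. $F(x,y) = F(y,x)$.
   Context: A dynamical system with double recursion is a tuple $\mathfrak{A} = (A, f, 0, 1)$ consisting of a finite set $A$, a function $f : A \times A \to A$, an element $1 \in A$ called the start symbol, and an element $0 \in A$ called the white colour. The development of $\mathfrak{A}$ is the function $a : \mathbb{N} \times \mathbb{N} \to A$ (with $0 \in \mathbb{N}$) defined by $a(i,j) = 1$ if $i = 0$ or $j = 0$, and $a(i,j) = f(a(i-1,j), a(i,j-1))$ if $i > 0$ and $j > 0$. $\mathfrak{A}$ is called ultimately zero if there exists $N \in \mathbb{N}$ such that for all $i, j \in \mathbb{N}$ with $i > 0$, $j > 0$ and $i + j > N$ one has $a(i,j) = 0$. Instances $(\mathbb{F}_q, F)$ are given as finite data: an explicit presentation of the finite field together with the list of coefficients of $F$. *)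

theory Defs
  imports
    "HOL-Algebra.QuotRing"
    "HOL-Number_Theory.Residues"
    "HOL-Library.Nat_Bijection"
begin

section \<open>Dynamical systems with double recursion\<close>

record 'a double_recursion =
  states :: "'a set"
  rule :: "'a \<Rightarrow> 'a \<Rightarrow> 'a"
  white :: 'a
  start :: 'a

definition double_recursion_system :: "'a double_recursion \<Rightarrow> bool" where
  "double_recursion_system \<AA> \<longleftrightarrow>
     finite (states \<AA>) \<and>
     (\<forall>x\<in>states \<AA>. \<forall>y\<in>states \<AA>. rule \<AA> x y \<in> states \<AA>) \<and>
     white \<AA> \<in> states \<AA> \<and> start \<AA> \<in> states \<AA>"

fun development :: "'a double_recursion \<Rightarrow> nat \<Rightarrow> nat \<Rightarrow> 'a" where
  "development \<AA> 0 j = start \<AA>"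
| "development \<AA> (Suc i) 0 = start \<AA>"
| "development \<AA> (Suc i) (Suc j) =
     rule \<AA> (development \<AA> i (Suc j)) (development \<AA> (Suc i) j)"

definition ultimately_zero :: "'a double_recursion \<Rightarrow> bool" where
  "ultimately_zero \<AA> \<longleftrightarrow>
     (\<exists>N. \<forall>i j. i > 0 \<and> j > 0 \<and> i + j > N \<longrightarrow> development \<AA> i j = white \<AA>)"


section \<open>Polynomials in two variables\<close>

text \<open>
  A polynomial over \<open>R\<close> in \<open>x, y\<close> is given by its coefficients: \<open>c i j\<close> is the coefficient
  of \<open>x\<^sup>i y\<^sup>j\<close>, and only finitely many are nonzero.
\<close>

definition bivariate_poly :: "('a, 'm) ring_scheme \<Rightarrow> (nat \<Rightarrow> nat \<Rightarrow> 'a) \<Rightarrow> bool" where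
  "bivariate_poly R c \<longleftrightarrow>
     (\<forall>i j. c i j \<in> carrier R) \<and> finite {(i, j). c i j \<noteq> \<zero>\<^bsub>R\<^esub>}"

definition poly_function ::
    "('a, 'm) ring_scheme \<Rightarrow> (nat \<Rightarrow> nat \<Rightarrow> 'a) \<Rightarrow> 'a \<Rightarrow> 'a \<Rightarrow> 'a" where
  "poly_function R c x y =
     finsum R (\<lambda>(i, j). c i j \<otimes>\<^bsub>R\<^esub> ((x [^]\<^bsub>R\<^esub> i) \<otimes>\<^bsub>R\<^esub> (y [^]\<^bsub>R\<^esub> j)))
       {(i, j). c i j \<noteq> \<zero>\<^bsub>R\<^esub>}"

definition symmetric_poly :: "(nat \<Rightarrow> nat \<Rightarrow> 'a) \<Rightarrow> bool" where
  "symmetric_poly c \<longleftrightarrow> (\<forall>i j. c i j = c j i)"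

definition poly_system ::
    "('a, 'm) ring_scheme \<Rightarrow> (nat \<Rightarrow> nat \<Rightarrow> 'a) \<Rightarrow> 'a double_recursion" where
  "poly_system R c =
     \<lparr>states = carrier R, rule = poly_function R c, white = \<zero>\<^bsub>R\<^esub>, start = \<one>\<^bsub>R\<^esub>\<rparr>"

definition prime_field :: "('a, 'm) ring_scheme \<Rightarrow> bool" where
  "prime_field R \<longleftrightarrow> (\<exists>p::nat. Factorial_Ring.prime p \<and> R \<simeq> residue_ring (int p))"


section \<open>Instances as finite data\<close>

text \<open>
  A finite field with \<open>q\<close> elements is presented on the carrier \<open>{0, \<dots>, q - 1}\<close> by the
  names of its zero and its unit together with its addition and multiplication tables.
  The names are arbitrary: the zero of the field need not be the number \<open>0\<close>.
  Entry \<open>j\<close> of row \<open>i\<close> of the coefficient list is the coefficient of \<open>x\<^sup>i y\<^sup>j\<close>;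
  rows may have different lengths, and missing entries stand for the zero of the field.
\<close>

record field_instance =
  field_order :: nat
  zero_name :: nat
  one_name :: nat
  add_table :: "nat list list"
  mult_table :: "nat list list"
  coeff_table :: "nat list list"

definition presented_ring :: "field_instance \<Rightarrow> nat ring" where
  "presented_ring I =
     \<lparr>carrier = {..<field_order I},
      monoid.mult = (\<lambda>x y. mult_table I ! x ! y),
      one = one_name I,
      zero = zero_name I,
      add = (\<lambda>x y. add_table I ! x ! y)\<rparr>"

definition presented_poly :: "field_instance \<Rightarrow> nat \<Rightarrow> nat \<Rightarrow> nat" where
  "presented_poly I i j =
     (if i < length (coeff_table I) \<and> j < length (coeff_table I ! i)
      then coeff_table I ! i ! j else zero_name I)"

definition square_table :: "nat \<Rightarrow> nat list list \<Rightarrow> bool" where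
  "square_table q t \<longleftrightarrow> length t = q \<and> (\<forall>r\<in>set t. length r = q)"

definition valid_instance :: "field_instance \<Rightarrow> bool" where
  "valid_instance I \<longleftrightarrow>
     square_table (field_order I) (add_table I) \<and>
     square_table (field_order I) (mult_table I) \<and>
     field (presented_ring I) \<and>
     (\<forall>r\<in>set (coeff_table I). set r \<subseteq> carrier (presented_ring I))"

definition instance_system :: "field_instance \<Rightarrow> nat double_recursion" where
  "instance_system I = poly_system (presented_ring I) (presented_poly I)"

definition table_encode :: "nat list list \<Rightarrow> nat" where
  "table_encode t = list_encode (map list_encode t)"

definition instance_encode :: "field_instance \<Rightarrow> nat" where
  "instance_encode I =
     list_encode [field_order I, zero_name I, one_name I,
       table_encode (add_table I), table_encode (mult_table I), table_encode (coeff_table I)]"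

lemma bivariate_poly_presented_poly:
  assumes "valid_instance I"
  shows "bivariate_poly (presented_ring I) (presented_poly I)"
proof -
  interpret field "presented_ring I"
    using assms by (simp add: valid_instance_def)
  have z: "zero_name I \<in> carrier (presented_ring I)"
    using zero_closed by (simp add: presented_ring_def)
  have "presented_poly I i j \<in> carrier (presented_ring I)" for i j
    using assms z unfolding valid_instance_def presented_poly_def
    by (auto intro: subsetD[OF _ nth_mem])
  moreover have "{(i, j). presented_poly I i j \<noteq> zero_name I} \<subseteq>
      Sigma {..<length (coeff_table I)} (\<lambda>i. {..<length (coeff_table I ! i)})"
    by (auto simp: presented_poly_def split: if_splits)
  then have "finite {(i, j). presented_poly I i j \<noteq> zero_name I}"
    by (rule finite_subset) auto
  ultimately show ?thesis
    by (simp add: bivariate_poly_def presented_ring_def)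
qed

lemma double_recursion_system_instance:
  assumes "valid_instance I"
  shows "double_recursion_system (instance_system I)"
proof -
  interpret field "presented_ring I"
    using assms by (simp add: valid_instance_def)
  have c: "presented_poly I i j \<in> carrier (presented_ring I)" for i j
    using bivariate_poly_presented_poly[OF assms] by (simp add: bivariate_poly_def)
  have "poly_function (presented_ring I) (presented_poly I) x y \<in> carrier (presented_ring I)"
    if "x \<in> carrier (presented_ring I)" "y \<in> carrier (presented_ring I)" for x y
    unfolding poly_function_def by (rule finsum_closed) (use that c in auto)
  moreover have "finite (carrier (presented_ring I))"
    by (simp add: presented_ring_def)
  ultimately show ?thesis
    by (simp add: double_recursion_system_def instance_system_def poly_system_def)
qed

lemma list_encode_inject: "list_encode xs = list_encode ys \<longleftrightarrow> xs = ys"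
  using inj_list_encode[of UNIV] by (auto dest: injD)

lemma inj_table_encode: "inj table_encode"
proof (rule injI)
  fix t u assume "table_encode t = table_encode u"
  then have "map list_encode t = map list_encode u"
    by (simp only: table_encode_def list_encode_inject)
  then show "t = u"
    by (rule map_injective) (rule inj_list_encode)
qed

lemma inj_instance_encode: "inj instance_encode"
proof (rule injI)
  fix I J assume "instance_encode I = instance_encode J"
  then show "I = J"
    unfolding instance_encode_def list_encode_inject
    by (simp add: inj_eq[OF inj_table_encode])
qed


section \<open>Computability\<close>

text \<open>
  Kleene's partial recursive functions. The arguments form a list, and a term denotes one
  partial function for every arity (which may have empty domain); the functions computed
  at arity \<open>n\<close> are exactly the \<open>n\<close>-ary partial recursive functions.
\<close>

datatype recf =
    Zero
  | Succ
  | Proj nat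
  | Comp recf "recf list"
  | PrimRec recf recf
  | Mu recf

inductive computes :: "recf \<Rightarrow> nat list \<Rightarrow> nat \<Rightarrow> bool" where
  Zero: "computes Zero xs 0"
| Succ: "computes Succ [x] (Suc x)"
| Proj: "i < length xs \<Longrightarrow> computes (Proj i) xs (xs ! i)"
| Comp: "list_all2 (\<lambda>g y. computes g xs y) gs ys \<Longrightarrow> computes f ys z \<Longrightarrow>
    computes (Comp f gs) xs z"
| PrimRec_0: "computes f xs z \<Longrightarrow> computes (PrimRec f g) (0 # xs) z"
| PrimRec_Suc: "computes (PrimRec f g) (n # xs) r \<Longrightarrow> computes g (n # r # xs) z \<Longrightarrow>
    computes (PrimRec f g) (Suc n # xs) z"
| Mu: "computes f (n # xs) 0 \<Longrightarrow> (\<And>m. m < n \<Longrightarrow> \<exists>y. computes f (m # xs) (Suc y)) \<Longrightarrow>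
    computes (Mu f) xs n"

text \<open>
  The question \<open>Q\<close> on the inputs in \<open>D\<close>, coded as numbers by \<open>enc\<close>, is decidable if some
  program halts with the correct answer on all these inputs. Nothing is required of the
  program on numbers that do not code an input in \<open>D\<close>.
\<close>

definition decidable_on :: "('i \<Rightarrow> nat) \<Rightarrow> 'i set \<Rightarrow> ('i \<Rightarrow> bool) \<Rightarrow> bool" where
  "decidable_on enc D Q \<longleftrightarrow>
     (\<exists>P. \<forall>x\<in>D. computes P [enc x] (if Q x then 1 else 0))"

inductive_cases computes_ZeroE: "computes Zero xs y"
inductive_cases computes_SuccE: "computes Succ xs y"
inductive_cases computes_ProjE: "computes (Proj i) xs y"
inductive_cases computes_CompE: "computes (Comp f gs) xs y"
inductive_cases computes_PrimRec_0E: "computes (PrimRec f g) (0 # xs) y"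
inductive_cases computes_PrimRec_SucE: "computes (PrimRec f g) (Suc n # xs) y"
inductive_cases computes_MuE: "computes (Mu f) xs y"

lemma computes_deterministic:
  assumes "computes f xs y" "computes f xs z"
  shows "y = z"
  using assms
proof (induction arbitrary: z rule: computes.induct)
  case (Zero xs)
  then show ?case by (rule computes_ZeroE) simp
next
  case (Succ x)
  then show ?case by (rule computes_SuccE) simp
next
  case (Proj i xs)
  from Proj.prems show ?case by (rule computes_ProjE) simp
next
  case (Comp xs gs ys f w)
  from Comp.prems show ?case
  proof (rule computes_CompE)
    fix ys'
    assume ys': "list_all2 (\<lambda>g. computes g xs) gs ys'" "computes f ys' z"
    have len: "length gs = length ys" "length gs = length ys'"
      using Comp.IH(1) ys'(1) by (auto dest: list_all2_lengthD)
    have "ys ! i = ys' ! i" if "i < length ys" for i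
      using list_all2_nthD2[OF Comp.IH(1) that] list_all2_nthD2[OF ys'(1), of i] that len
      by simp
    then have "ys = ys'"
      using len by (simp add: list_eq_iff_nth_eq)
    then show "w = z"
      using Comp.IH(2) ys'(2) by blast
  qed
next
  case (PrimRec_0 f xs w g)
  from PrimRec_0.prems have "computes f xs z" by (rule computes_PrimRec_0E)
  then show ?case by (rule PrimRec_0.IH)
next
  case (PrimRec_Suc f g n xs r w)
  from PrimRec_Suc.prems show ?case
  proof (rule computes_PrimRec_SucE)
    fix r'
    assume r': "computes (PrimRec f g) (n # xs) r'" "computes g (n # r' # xs) z"
    show "w = z"
      using PrimRec_Suc.IH(1)[OF r'(1)] PrimRec_Suc.IH(2) r'(2) by simp
  qed
next
  case (Mu f n xs)
  have z: "computes f (z # xs) 0" "m < z \<Longrightarrow> \<exists>y. computes f (m # xs) (Suc y)" for m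
    by (rule computes_MuE[OF Mu.prems], simp)+
  have "\<not> z < n"
  proof
    assume "z < n"
    from Mu.IH(2)[OF this] obtain y where "\<forall>w. computes f (z # xs) w \<longrightarrow> Suc y = w" by blast
    with z(1) show False by blast
  qed
  moreover have "\<not> n < z"
  proof
    assume "n < z"
    from z(2)[OF this] obtain y where "computes f (n # xs) (Suc y)" by blast
    from Mu.IH(1)[OF this] show False by simp
  qed
  ultimately show ?case by simp
qed

end

theory Submission
  imports Defs "HOL-Library.Countable"
begin

text \<open>
  The argument is a diagonalisation that needs no universal machine. If \<open>P\<close> decided the
  question for symmetric polynomials over prime fields, a program \<open>D\<close> could, on input \<open>d\<close>,
  build a certain system \<open>S\<^sub>d\<close> over a prime field and run \<open>P\<close> on it. The program \<open>D\<close> is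
  compiled to a machine working on a queue, and the table of local rules of this machine is
  coded by a number. When \<open>d\<close> is that number, \<open>S\<^sub>d\<close> simulates the run of \<open>D\<close> on \<open>d\<close>, and
  the run is prolonged such that it halts if and only if \<open>P\<close> claims that \<open>S\<^sub>d\<close> is not
  ultimately zero.

  In the simulation row \<open>j\<close>, read from the diagonal outwards, displays the content of the queue
  at time \<open>j\<close>: computing row \<open>j + 1\<close> from row \<open>j\<close> drops the letter on the diagonal, and every
  cell carries the reaction to this letter along the row, to be appended at its end. The
  label \<open>\<bar>i - j\<bar> mod 3\<close> tells which of the two neighbours is the outer one, so the rule can be
  commutative. A halting run turns the whole row into zeros. The input enters through the
  constant row \<open>1, 1, 1, \<dots>\<close>, on which the elements \<open>d, d + 1, \<dots>, 2 d + 1\<close> of the field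
  count the letters of the initial queue.
\<close>

section \<open>Recursive functions of environments\<close>

text \<open>
  Arguments are given as an environment \<open>e\<close> instead of a list, so that instantiating a bound
  variable is a \<open>\<beta>\<close>-reduction and the closure rules below apply by plain unification.
\<close>

definition recursive :: "nat \<Rightarrow> ((nat \<Rightarrow> nat) \<Rightarrow> nat) \<Rightarrow> bool" where
  "recursive k F \<longleftrightarrow> (\<exists>P. \<forall>e. computes P (map e [0..<k]) (F e))"

lemma map_case_nat_upt: "map (case_nat n e) [0..<Suc k] = n # map e [0..<k]"
  by (simp only: map_upt_Suc nat.case)

lemma recursive_var [intro]: "i < k \<Longrightarrow> recursive k (\<lambda>e. e i)"
  unfolding recursive_def
  by (metis computes.Proj diff_zero length_map length_upt nth_map_upt add_0)

text \<open>A program for \<open>G\<close> sees only the first \<open>m\<close> values of its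
  environment, so \<open>Comp\<close> with the programs for \<open>F 0\<close>, ...,
  \<open>F (m - 1)\<close> computes the composition.\<close>

lemma recursive_subst:
  assumes "recursive m G" "\<And>i. i < m \<Longrightarrow> recursive k (F i)"
  shows "recursive k (\<lambda>e. G (\<lambda>i. F i e))"
proof -
  obtain P where P: "\<And>e. computes P (map e [0..<m]) (G e)"
    using assms(1) by (auto simp: recursive_def)
  obtain Q where Q: "\<And>i e. i < m \<Longrightarrow> computes (Q i) (map e [0..<k]) (F i e)"
    using assms(2) unfolding recursive_def by metis
  have "computes (Comp P (map Q [0..<m])) (map e [0..<k]) (G (\<lambda>i. F i e))" for e
    using P[of "\<lambda>i. F i e"] Q
    by (intro computes.Comp[where ys = "map (\<lambda>i. F i e) [0..<m]"])
      (auto simp: list_all2_conv_all_nth)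
  then show ?thesis
    unfolding recursive_def by blast
qed

lemma recursive_unary:
  assumes "recursive 1 (\<lambda>e. f (e 0))" "recursive k F"
  shows "recursive k (\<lambda>e. f (F e))"
  using recursive_subst[OF assms(1), of k "\<lambda>_. F"] assms(2) by simp

lemma recursive_binary:
  assumes "recursive 2 (\<lambda>e. f (e 0) (e 1))" "recursive k F" "recursive k G"
  shows "recursive k (\<lambda>e. f (F e) (G e))"
  using recursive_subst[OF assms(1), of k "\<lambda>i. if i = 0 then F else G"] assms(2,3) by simp

lemma recursive_ternary:
  assumes "recursive 3 (\<lambda>e. f (e 0) (e 1) (e 2))" "recursive k F" "recursive k G" "recursive k H"
  shows "recursive k (\<lambda>e. f (F e) (G e) (H e))"
  using recursive_subst[OF assms(1), of k "\<lambda>i. if i = 0 then F else if i = 1 then G else H"]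
    assms(2-4) by simp

lemma recursive_Suc:
  assumes "recursive k F"
  shows "recursive k (\<lambda>e. Suc (F e))"
proof (rule recursive_unary[OF _ assms])
  have "computes Succ (map e [0..<1]) (Suc (e 0))" for e
    by (simp add: computes.Succ)
  then show "recursive 1 (\<lambda>e. Suc (e 0))"
    unfolding recursive_def by blast
qed

lemma recursive_const [intro]: "recursive k (\<lambda>e. c)"
proof (induction c)
  case 0
  show ?case
    unfolding recursive_def using computes.Zero by blast
qed (rule recursive_Suc)

lemma recursive_rec_nat:
  assumes A: "recursive k A" and B: "recursive (Suc (Suc k)) (\<lambda>e. B (e 0) (e 1) (\<lambda>i. e (Suc (Suc i))))"
    and N: "recursive k N"
  shows "recursive k (\<lambda>e. rec_nat (A e) (\<lambda>n r. B n r e) (N e))"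
proof -
  obtain P where P: "\<And>e. computes P (map e [0..<k]) (A e)"
    using A by (auto simp: recursive_def)
  obtain Q where Q: "\<And>e. computes Q (map e [0..<Suc (Suc k)]) (B (e 0) (e 1) (\<lambda>i. e (Suc (Suc i))))"
    using B by (auto simp: recursive_def)
  have Q': "computes Q (n # r # map e [0..<k]) (B n r e)" for n r e
    using Q[of "case_nat n (case_nat r e)"] by (simp only: map_case_nat_upt nat.case One_nat_def)
  have R: "computes (PrimRec P Q) (n # map e [0..<k]) (rec_nat (A e) (\<lambda>n r. B n r e) n)" for n e
    by (induction n) (auto intro: computes.PrimRec_0 computes.PrimRec_Suc P Q')
  have "computes (PrimRec P Q) (map e [0..<Suc k]) (rec_nat (A (\<lambda>i. e (Suc i))) (\<lambda>n r. B n r (\<lambda>i. e (Suc i))) (e 0))" for e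
    unfolding map_upt_Suc by (rule R)
  then have "recursive (Suc k) (\<lambda>e. rec_nat (A (\<lambda>i. e (Suc i))) (\<lambda>n r. B n r (\<lambda>i. e (Suc i))) (e 0))"
    unfolding recursive_def by blast
  \<comment> \<open>\<open>PrimRec\<close> recurses on its first argument; substituting
    \<open>N\<close> for it and shifting the other arguments gives the claim.\<close>
  moreover have "recursive k (case_nat N (\<lambda>i e. e i) i)" if "i < Suc k" for i
    using that N by (cases i) auto
  ultimately show ?thesis
    using recursive_subst[of "Suc k" _ k "case_nat N (\<lambda>i e. e i)"] by fastforce
qed

text \<open>Unbounded search: \<open>ex\<close> makes it end in every environment, and as
  \<open>B\<close> is total, every rejected candidate yields a positive value.\<close>

lemma recursive_Least:
  assumes B: "recursive (Suc k) (\<lambda>e. B (e 0) (\<lambda>i. e (Suc i)))" and ex: "\<And>e. \<exists>z. B z e = 0"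
  shows "recursive k (\<lambda>e. LEAST z. B z e = 0)"
proof -
  obtain Q where Q: "\<And>e. computes Q (map e [0..<Suc k]) (B (e 0) (\<lambda>i. e (Suc i)))"
    using B by (auto simp: recursive_def)
  have Q': "computes Q (n # map e [0..<k]) (B n e)" for n e
    using Q[of "case_nat n e"] by (simp only: map_case_nat_upt nat.case)
  have "computes (Mu Q) (map e [0..<k]) (LEAST z. B z e = 0)" for e
  proof (rule computes.Mu)
    have "B (LEAST z. B z e = 0) e = 0"
      by (rule LeastI_ex) (rule ex)
    with Q' show "computes Q ((LEAST z. B z e = 0) # map e [0..<k]) 0"
      by metis
    fix m assume "m < (LEAST z. B z e = 0)"
    then have "B m e \<noteq> 0"
      using not_less_Least by blast
    with Q' show "\<exists>y. computes Q (m # map e [0..<k]) (Suc y)"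
      by (metis not0_implies_Suc)
  qed
  then show ?thesis
    unfolding recursive_def by blast
qed

section \<open>Arithmetic and logical operations\<close>

lemma recursive_add:
  assumes "recursive k F" "recursive k G"
  shows "recursive k (\<lambda>e. F e + G e)"
proof -
  have eq: "rec_nat x (\<lambda>n r. Suc r) y = x + y" for x y :: nat
    by (induction y) auto
  show ?thesis
    using recursive_rec_nat[of k F "\<lambda>n r e. Suc r" G] assms by (simp add: eq recursive_Suc recursive_var)
qed

lemma recursive_mult:
  assumes "recursive k F" "recursive k G"
  shows "recursive k (\<lambda>e. F e * G e)"
proof (rule recursive_binary[OF _ assms])
  have eq: "rec_nat 0 (\<lambda>n r. r + x) y = x * y" for x y :: nat
    by (induction y) auto
  show "recursive 2 (\<lambda>e. e 0 * e 1)"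
    using recursive_rec_nat[of 2 "\<lambda>e. 0" "\<lambda>n r e. r + e 0" "\<lambda>e. e 1"]
    by (simp add: eq recursive_add recursive_var recursive_const)
qed

lemma recursive_power:
  assumes "recursive k F" "recursive k G"
  shows "recursive k (\<lambda>e. F e ^ G e)"
proof (rule recursive_binary[OF _ assms])
  have eq: "rec_nat 1 (\<lambda>n r. r * x) y = x ^ y" for x y :: nat
    by (induction y) auto
  show "recursive 2 (\<lambda>e. e 0 ^ e 1)"
    using recursive_rec_nat[of 2 "\<lambda>e. 1" "\<lambda>n r e. r * e 0" "\<lambda>e. e 1"]
    by (simp only: eq) (simp add: recursive_mult recursive_var recursive_const)
qed

lemma recursive_diff:
  assumes "recursive k F" "recursive k G"
  shows "recursive k (\<lambda>e. F e - G e)"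
proof (rule recursive_binary[OF _ assms])
  have "rec_nat 0 (\<lambda>n r. n) x = x - 1" for x :: nat
    by (cases x) auto
  then have pred: "recursive 1 (\<lambda>e. e 0 - 1)"
    using recursive_rec_nat[of 1 "\<lambda>e. 0" "\<lambda>n r e. n" "\<lambda>e. e 0"]
    by (simp add: recursive_var recursive_const)
  have eq: "rec_nat x (\<lambda>n r. r - 1) y = x - y" for x y :: nat
    by (induction y) auto
  show "recursive 2 (\<lambda>e. e 0 - e 1)"
    using recursive_rec_nat[of 2 "\<lambda>e. e 0" "\<lambda>n r e. r - 1" "\<lambda>e. e 1"]
    by (simp only: eq) (simp add: recursive_unary[OF pred, simplified] recursive_var)
qed

lemma recursive_less:
  assumes "recursive k F" "recursive k G"
  shows "recursive k (\<lambda>e. of_bool (F e < G e))"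
proof -
  have "of_bool (x < y) = 1 - (1 - (y - x))" for x y :: nat by simp
  then show ?thesis
    by (simp only:) (intro recursive_diff recursive_const assms)
qed

lemma recursive_not:
  assumes "recursive k (\<lambda>e. of_bool (P e))"
  shows "recursive k (\<lambda>e. of_bool (\<not> P e))"
proof -
  have "of_bool (\<not> P e) = (1 - of_bool (P e) :: nat)" for e by simp
  then show ?thesis
    by (simp only:) (intro recursive_diff recursive_const assms)
qed

lemma recursive_conj:
  assumes "recursive k (\<lambda>e. of_bool (P e))" "recursive k (\<lambda>e. of_bool (Q e))"
  shows "recursive k (\<lambda>e. of_bool (P e \<and> Q e))"
  unfolding of_bool_conj by (intro recursive_mult assms)

lemma recursive_le:
  assumes "recursive k F" "recursive k G"
  shows "recursive k (\<lambda>e. of_bool (F e \<le> G e))"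
  unfolding not_less[symmetric] by (intro recursive_not recursive_less assms)

lemma recursive_eq:
  assumes "recursive k F" "recursive k G"
  shows "recursive k (\<lambda>e. of_bool (F e = G e))"
  unfolding eq_iff by (intro recursive_conj recursive_le assms)

lemma recursive_if:
  assumes "recursive k (\<lambda>e. of_bool (P e))" "recursive k F" "recursive k G"
  shows "recursive k (\<lambda>e. if P e then F e else G e)"
proof -
  have "(if P e then F e else G e) = of_bool (P e) * F e + of_bool (\<not> P e) * G e" for e by simp
  then show ?thesis
    by (simp only:) (intro recursive_add recursive_mult recursive_not assms)
qed

lemma recursive_sum:
  assumes "recursive (Suc k) (\<lambda>e. B (e 0) (\<lambda>i. e (Suc i)))" "recursive k N"
  shows "recursive k (\<lambda>e. \<Sum>z<N e. B z e)"
proof -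
  have eq: "rec_nat 0 (\<lambda>n r. r + B n e) N = (\<Sum>z<N. B z e)" for e N
    by (induction N) auto
  \<comment> \<open>\<open>G\<close> removes the running total \<open>e 1\<close>, which the summand
    must not see.\<close>
  define G where "G = (\<lambda>i e. if i = 0 then e 0 else e (Suc i) :: nat)"
  have "recursive (Suc (Suc k)) (G i)" if "i < Suc k" for i
    using that by (cases i) (auto simp: G_def)
  from recursive_subst[where F = G, OF assms(1) this]
  have "recursive (Suc (Suc k)) (\<lambda>e. B (e 0) (\<lambda>i. e (Suc (Suc i))))"
    by (simp add: G_def)
  then have "recursive (Suc (Suc k)) (\<lambda>e. e 1 + B (e 0) (\<lambda>i. e (Suc (Suc i))))"
    by (intro recursive_add) auto
  from recursive_rec_nat[of k "\<lambda>e. 0" "\<lambda>n r e. r + B n e" N, OF _ this assms(2)]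
  show ?thesis
    by (simp add: eq recursive_const)
qed

lemma recursive_div:
  assumes "recursive k F" "recursive k G"
  shows "recursive k (\<lambda>e. F e div G e)"
proof (rule recursive_binary[OF _ assms])
  \<comment> \<open>The quotient counts the positive multiples of \<open>y\<close> up to
    \<open>x\<close>; the conjunct \<open>0 < y\<close> yields the convention
    \<open>x div 0 = 0\<close>.\<close>
  have eq: "(\<Sum>z<x. of_bool (0 < y \<and> Suc z * y \<le> x)) = x div y" for x y :: nat
  proof (cases "y = 0")
    case False
    have "(0 < y \<and> Suc z * y \<le> x) \<longleftrightarrow> z < x div y" for z
      using less_eq_div_iff_mult_less_eq[of y "Suc z" x] False by (simp add: Suc_le_eq del: mult_Suc)
    moreover have "{..<x} \<inter> {z. z < x div y} = {..<x div y}"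
      by (auto intro: less_le_trans)
    ultimately show ?thesis
      by simp
  qed simp
  have "recursive 2 (\<lambda>e. \<Sum>z<e 0. of_bool (0 < e 1 \<and> Suc z * e 1 \<le> e 0))"
    by (intro recursive_sum recursive_conj recursive_less recursive_le recursive_mult recursive_Suc
        recursive_var recursive_const) simp_all
  then show "recursive 2 (\<lambda>e. e 0 div e 1)"
    by (simp only: eq)
qed

lemma recursive_mod:
  assumes "recursive k F" "recursive k G"
  shows "recursive k (\<lambda>e. F e mod G e)"
  unfolding minus_div_mult_eq_mod[symmetric]
  by (intro recursive_diff recursive_mult recursive_div assms)

section \<open>Codes of pairs and lists\<close>

lemma recursive_prod_encode:
  assumes "recursive k F" "recursive k G"
  shows "recursive k (\<lambda>e. prod_encode (F e, G e))"
  unfolding prod_encode_def triangle_def prod.case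
  by (intro recursive_add recursive_div recursive_mult recursive_Suc recursive_const assms)

lemma recursive_list_encode:
  assumes F: "recursive (Suc k) (\<lambda>e. F (e 0) (\<lambda>i. e (Suc i)))" and N: "recursive k N"
  shows "recursive k (\<lambda>e. list_encode (map (\<lambda>i. F i e) [0..<N e]))"
proof -
  \<comment> \<open>The code of a list is built from its end: step \<open>n\<close> prepends entry
    \<open>N e - Suc n\<close>.\<close>
  let ?B = "\<lambda>n r e. Suc (prod_encode (F (N e - Suc n) e, r))"
  have eq: "rec_nat 0 (\<lambda>n r. ?B n r e) m = list_encode (map (\<lambda>i. F i e) [N e - m..<N e])"
    if "m \<le> N e" for e m
    using that
  proof (induction m)
    case (Suc m)
    then have "[N e - Suc m..<N e] = (N e - Suc m) # [N e - m..<N e]"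
      by (subst upt_conv_Cons) (simp_all add: Suc_diff_Suc)
    with Suc show ?case by simp
  qed simp
  define G where "G = case_nat (\<lambda>e::nat\<Rightarrow>nat. N (\<lambda>i. e (Suc (Suc i))) - Suc (e 0)) (\<lambda>i e. e (Suc (Suc i)))"
  have "recursive (Suc (Suc k)) (\<lambda>e. N (\<lambda>i. e (Suc (Suc i))))"
    by (rule recursive_subst[OF N]) auto
  then have "recursive (Suc (Suc k)) (G i)" if "i < Suc k" for i
    using that unfolding G_def
    by (cases i) (auto intro!: recursive_diff recursive_Suc recursive_var)
  from recursive_subst[where F = G, OF F this]
  have "recursive (Suc (Suc k)) (\<lambda>e. F (N (\<lambda>i. e (Suc (Suc i))) - Suc (e 0)) (\<lambda>i. e (Suc (Suc i))))"
    by (simp add: G_def)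
  then have "recursive (Suc (Suc k)) (\<lambda>e. ?B (e 0) (e 1) (\<lambda>i. e (Suc (Suc i))))"
    by (intro recursive_Suc recursive_prod_encode) auto
  from recursive_rec_nat[where B = ?B, OF recursive_const[of k 0] this N] eq[OF order_refl]
  show ?thesis by simp
qed

section \<open>Systems coded by numbers\<close>

text \<open>
  The binary digits of \<open>d\<close> code a finite table of triples \<open>(x, y, z)\<close>, read as \<open>x, y \<mapsto> z\<close>.
\<close>

definition lookup :: "nat \<Rightarrow> nat \<Rightarrow> nat \<Rightarrow> nat" where
  "lookup d x y = (\<Sum>z<d. z * (d div 2 ^ prod_encode (x, prod_encode (y, z)) mod 2))"

text \<open>
  The elements from \<open>d\<close> on stand for the cells of the initial queue, whose codes are \<open>2\<close>, \<open>3\<close>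
  and \<open>4\<close>, according to their label.
\<close>

definition view :: "nat \<Rightarrow> nat \<Rightarrow> nat" where
  "view d x = (if x < d then x else 2 + (x - d) mod 3)"

text \<open>The value 1 is reserved for the border. Next to it the elements from \<open>d\<close> on
  count up to \<open>2 * d + 1\<close> and then give way to 0, which produces row 1; pairs without a
  1 follow the table.\<close>

definition local_rule :: "nat \<Rightarrow> nat \<Rightarrow> nat \<Rightarrow> nat" where
  "local_rule d x y =
     (if x = 1 \<and> y = 1 then d
      else if x = 1 then (if d \<le> y \<and> y < 2 * d + 1 then Suc y else 0)
      else if y = 1 then (if d \<le> x \<and> x < 2 * d + 1 then Suc x else 0)
      else lookup d (view d x) (view d y))"

text \<open>The least prime from \<open>2 * d + 6\<close> on, written as the least zero of an
  arithmetic term to suit \<open>recursive_Least\<close>. It exceeds all elements in use, the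
  largest being \<open>2 * d + 1\<close>.\<close>

definition modulus :: "nat \<Rightarrow> nat" where
  "modulus d = (LEAST p. (\<Sum>k<p. of_bool (2 \<le> k \<and> p mod k = 0)) + (2 * d + 6 - p) = 0)"

text \<open>
  The coefficient of \<open>x\<^sup>i\<close> in \<open>1 - (x - a)\<^sup>p\<^sup>-\<^sup>1\<close>, the indicator function of \<open>a\<close>, modulo \<open>p\<close>:
  all binomial coefficients \<open>(p - 1) choose i\<close> are \<open>\<plusminus>1\<close>, with signs cancelling those of \<open>-a\<close>.
\<close>

definition basis_coeff :: "nat \<Rightarrow> nat \<Rightarrow> nat \<Rightarrow> nat" where
  "basis_coeff p a i = (if i = 0 then 1 else 0) + (p - 1) * a ^ (p - 1 - i)"

definition interpolation_coeff :: "nat \<Rightarrow> (nat \<Rightarrow> nat \<Rightarrow> nat) \<Rightarrow> nat \<Rightarrow> nat \<Rightarrow> nat" where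
  "interpolation_coeff p f i j =
     (\<Sum>a<p. \<Sum>b<p. f a b * basis_coeff p a i * basis_coeff p b j) mod p"

definition table :: "nat \<Rightarrow> (nat \<Rightarrow> nat \<Rightarrow> nat) \<Rightarrow> nat list list" where
  "table p f = map (\<lambda>i. map (\<lambda>j. f i j) [0..<p]) [0..<p]"

definition prime_instance :: "nat \<Rightarrow> (nat \<Rightarrow> nat \<Rightarrow> nat) \<Rightarrow> field_instance" where
  "prime_instance p f =
     \<lparr>field_order = p, zero_name = 0, one_name = 1,
      add_table = table p (\<lambda>i j. (i + j) mod p),
      mult_table = table p (\<lambda>i j. (i * j) mod p),
      coeff_table = table p (interpolation_coeff p f)\<rparr>"

lemmas recursive_intros =
  recursive_sum recursive_list_encode recursive_if recursive_conj recursive_not recursive_eq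
  recursive_le recursive_less recursive_prod_encode recursive_mod recursive_div recursive_power
  recursive_mult recursive_diff recursive_add recursive_Suc

section \<open>Computability of the prime and of the instance\<close>

lemma ex_modulus:
  "\<exists>p::nat. (\<Sum>k<p. of_bool (2 \<le> k \<and> p mod k = 0)) + (2 * d + 6 - p) = 0"
proof -
  obtain p where p: "prime p" "2 * d + 6 < p"
    using bigger_prime by blast
  then have "\<not> (2 \<le> k \<and> k dvd p)" if "k < p" for k
    using that prime_nat_iff[of p] by auto
  then have "{..<p} \<inter> {k. 2 \<le> k \<and> p mod k = 0} = {}"
    by (auto simp: mod_eq_0_iff_dvd)
  with p show ?thesis
    by (intro exI[of _ p]) simp
qed

lemma modulus: "prime (modulus d)" "2 * d + 6 \<le> modulus d"
proof -
  have *: "(\<Sum>k<modulus d. of_bool (2 \<le> k \<and> modulus d mod k = 0)) + (2 * d + 6 - modulus d) = 0"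
    unfolding modulus_def by (rule LeastI_ex) (rule ex_modulus)
  then show "2 * d + 6 \<le> modulus d" by simp
  moreover have "\<not> (2 \<le> k \<and> k dvd modulus d)" if "k < modulus d" for k
    using * that by (auto simp: mod_eq_0_iff_dvd)
  ultimately show "prime (modulus d)"
    unfolding prime_nat_iff'
    by (auto simp: Suc_le_eq)
qed

lemma recursive_modulus: "recursive 1 (\<lambda>e. modulus (e 0))"
  unfolding modulus_def
proof (rule recursive_Least)
  show "recursive (Suc 1) (\<lambda>e. (\<Sum>k<e 0. of_bool (2 \<le> k \<and> e 0 mod k = 0)) + (2 * e (Suc 0) + 6 - e 0))"
    by (intro recursive_intros recursive_var recursive_const) simp_all
qed (rule ex_modulus)

lemma recursive_local_rule: "recursive 3 (\<lambda>e. local_rule (e 0) (e 1) (e 2))"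
  unfolding local_rule_def view_def lookup_def
  by (intro recursive_intros recursive_var recursive_const) simp_all

lemma recursive_basis_coeff: "recursive 3 (\<lambda>e. basis_coeff (e 0) (e 1) (e 2))"
  unfolding basis_coeff_def
  by (intro recursive_intros recursive_var recursive_const) simp_all

lemma recursive_prime_instance:
  "recursive 1 (\<lambda>e. instance_encode (prime_instance (modulus (e 0)) (local_rule (e 0))))"
proof -
  have table: "table_encode (table p f) = list_encode (map (\<lambda>i. list_encode (map (f i) [0..<p])) [0..<p])"
    for p f
    by (simp add: table_encode_def table_def o_def)
  show ?thesis
    unfolding instance_encode_def prime_instance_def field_instance.simps table interpolation_coeff_def
      list_encode.simps
    by (intro recursive_intros recursive_unary[OF recursive_modulus]
        recursive_ternary[OF recursive_local_rule] recursive_ternary[OF recursive_basis_coeff]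
        recursive_var recursive_const) simp_all
qed

section \<open>Polynomial systems over prime fields\<close>

lemma table_nth: "i < p \<Longrightarrow> j < p \<Longrightarrow> table p f ! i ! j = f i j"
  by (simp add: table_def)

lemma square_table_table: "square_table p (table p f)"
  by (auto simp: square_table_def table_def)

section \<open>The integers modulo \<open>p\<close> as tables\<close>

locale prime_presentation =
  fixes p :: nat and f :: "nat \<Rightarrow> nat \<Rightarrow> nat"
  assumes prime: "Factorial_Ring.prime p"
begin

abbreviation "R \<equiv> presented_ring (prime_instance p f)"

lemma carrier_R: "carrier R = {..<p}" and one_R: "\<one>\<^bsub>R\<^esub> = 1" and zero_R: "\<zero>\<^bsub>R\<^esub> = 0"
  by (simp_all add: presented_ring_def prime_instance_def)

lemma add_R: "x < p \<Longrightarrow> y < p \<Longrightarrow> x \<oplus>\<^bsub>R\<^esub> y = (x + y) mod p"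
  and mult_R: "x < p \<Longrightarrow> y < p \<Longrightarrow> x \<otimes>\<^bsub>R\<^esub> y = (x * y) mod p"
  by (simp_all add: presented_ring_def prime_instance_def table_nth)

lemma p_gt_1: "p > 1"
  using prime by (rule prime_gt_1_nat)

lemma nat_in_ring_iso: "nat \<in> ring_iso (residue_ring (int p)) R"
proof (rule ring_iso_memI)
  fix x y :: int
  assume "x \<in> carrier (residue_ring (int p))" "y \<in> carrier (residue_ring (int p))"
  then have xy: "0 \<le> x" "x < int p" "0 \<le> y" "y < int p"
    by (auto simp: residue_ring_def)
  then show "nat x \<in> carrier R"
    by (simp add: carrier_R nat_less_iff)
  show "nat (x \<otimes>\<^bsub>residue_ring (int p)\<^esub> y) = nat x \<otimes>\<^bsub>R\<^esub> nat y"
    using xy by (simp add: mult_R nat_less_iff residue_ring_def nat_mod_distrib nat_mult_distrib)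
  show "nat (x \<oplus>\<^bsub>residue_ring (int p)\<^esub> y) = nat x \<oplus>\<^bsub>R\<^esub> nat y"
    using xy by (simp add: add_R nat_less_iff residue_ring_def nat_mod_distrib nat_add_distrib)
next
  show "nat \<one>\<^bsub>residue_ring (int p)\<^esub> = \<one>\<^bsub>R\<^esub>"
    by (simp add: one_R residue_ring_def)
  show "bij_betw nat (carrier (residue_ring (int p))) (carrier R)"
    unfolding carrier_R
    by (rule bij_betwI[where g = int]) (auto simp: residue_ring_def nat_less_iff)
qed

lemma field_residue_ring: "field (residue_ring (int p))"
proof -
  have "residues_prime p"
    using prime by unfold_locales
  then show ?thesis
    by (rule residues_prime.is_field)
qed

lemma field_R: "field R"
proof -
  from field_residue_ring have "field (R\<lparr>zero := nat \<zero>\<^bsub>residue_ring (int p)\<^esub>\<rparr>)"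
    by (rule field.ring_iso_imp_img_field) (rule nat_in_ring_iso)
  moreover have "R\<lparr>zero := nat \<zero>\<^bsub>residue_ring (int p)\<^esub>\<rparr> = R"
    by (simp add: residue_ring_def presented_ring_def prime_instance_def)
  ultimately show ?thesis by simp
qed

sublocale field R
  by (rule field_R)

lemma prime_field_R: "prime_field R"
proof -
  interpret F: field "residue_ring (int p)"
    by (rule field_residue_ring)
  have "ring (residue_ring (int p))"
    by (rule F.ring_axioms)
  moreover have "residue_ring (int p) \<simeq> R"
    using nat_in_ring_iso by (auto simp: is_ring_iso_def)
  ultimately have "R \<simeq> residue_ring (int p)"
    by (rule ring_iso_sym)
  with prime show ?thesis
    unfolding prime_field_def by blast
qed

lemma presented_poly_eq:
  "presented_poly (prime_instance p f) i j =
     (if i < p \<and> j < p then interpolation_coeff p f i j else 0)"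
  by (auto simp: presented_poly_def prime_instance_def table_def)

lemma interpolation_coeff_less: "interpolation_coeff p f i j < p"
  using p_gt_1 by (simp add: interpolation_coeff_def)

lemma valid: "valid_instance (prime_instance p f)"
  using field_R square_table_table interpolation_coeff_less
  by (auto simp: valid_instance_def carrier_R) (auto simp: prime_instance_def table_def)

lemma symmetric:
  assumes "\<And>x y. f x y = f y x"
  shows "symmetric_poly (presented_poly (prime_instance p f))"
proof -
  have "interpolation_coeff p f i j = interpolation_coeff p f j i" for i j
    unfolding interpolation_coeff_def
    by (subst sum.swap) (simp add: assms mult.assoc mult.commute mult.left_commute)
  then show ?thesis
    by (simp add: symmetric_poly_def presented_poly_eq)
qed

section \<open>Interpolation of degree below \<open>p\<close> in each variable\<close>

lemma nat_pow_R: "x < p \<Longrightarrow> x [^]\<^bsub>R\<^esub> n = x ^ n mod p"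
proof (induction n)
  case 0
  then show ?case using p_gt_1 by (simp add: one_R)
next
  case (Suc n)
  then show ?case
    by (simp add: nat_pow_Suc mult_R mod_mult_right_eq mult.commute)
qed

lemma finsum_R:
  assumes "finite A" "\<And>x. x \<in> A \<Longrightarrow> g x < p"
  shows "finsum R g A = (\<Sum>x\<in>A. g x) mod p"
  using assms
proof (induction A rule: finite_induct)
  case empty
  then show ?case by (simp add: zero_R)
next
  case (insert x A)
  then have "finsum R g (insert x A) = g x \<oplus>\<^bsub>R\<^esub> finsum R g A"
    by (intro finsum_insert) (auto simp: carrier_R)
  with insert p_gt_1 show ?case
    by (simp add: add_R mod_add_right_eq)
qed

text \<open>The sum is \<open>1 + (p - 1) * S\<close>, that is, \<open>1 - S\<close> modulo
  \<open>p\<close>. For \<open>x = a\<close> all \<open>p\<close> terms of \<open>S\<close> equal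
  \<open>a ^ (p - 1)\<close>, so \<open>S\<close> vanishes; otherwise
  \<open>(x - a) * S = x ^ p - a ^ p\<close>, which is \<open>x - a\<close> by Fermat, so
  \<open>S\<close> is 1.\<close>

lemma basis_sum:
  assumes "a < p" "x < p"
  shows "[(\<Sum>i<p. basis_coeff p a i * x ^ i) = of_bool (x = a)] (mod p)"
proof -
  define S where "S = (\<Sum>i<p. a ^ (p - 1 - i) * x ^ i)"
  have p: "{..<p} = insert 0 {1..<p}"
    using p_gt_1 by auto
  have "(\<Sum>i<p. (if i = 0 then 1 else 0) * x ^ i) = (1::nat)"
    unfolding p by (subst sum.insert) auto
  then have sum: "(\<Sum>i<p. basis_coeff p a i * x ^ i) = 1 + (p - 1) * S"
    by (simp add: basis_coeff_def S_def add_mult_distrib sum.distrib sum_distrib_left mult.assoc)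
  show ?thesis
  proof (cases "x = a")
    case True
    have "S = (\<Sum>i<p. a ^ (p - 1))"
      unfolding S_def True by (intro sum.cong) (simp_all flip: power_add)
    then have "(p - 1) * S = p * ((p - 1) * a ^ (p - 1))"
      by (simp only: sum_constant card_lessThan of_nat_id mult.left_commute)
    then show ?thesis
      unfolding sum cong_def by (simp only: mod_mult_self2 True of_bool_eq simp_thms)
  next
    case False
    have "[z ^ p = z] (mod p)" for z
    proof (cases "p dvd z")
      case True
      then have "p dvd z ^ p"
        using p_gt_1 dvd_trans[OF True dvd_power[of p z]] by simp
      with True show ?thesis
        by (simp add: cong_def)
    next
      case False
      then have "[z ^ (p - 1) = 1] (mod p)"
        using fermat_theorem prime by blast
      then have "[z ^ (p - 1) * z = 1 * z] (mod p)"
        by (rule cong_scalar_right)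
      then show ?thesis
        using p_gt_1 by (simp add: power_eq_if mult.commute)
    qed
    then have fermat: "[int z ^ p = int z] (mod int p)" for z
      by (metis cong_int_iff of_nat_power)
    have "(int x - int a) * int S = int x ^ p - int a ^ p"
      unfolding S_def by (subst power_diff_sumr2) simp
    moreover have "[int x ^ p - int a ^ p = int x - int a] (mod int p)"
      by (intro cong_diff fermat)
    ultimately have "[(int x - int a) * int S = (int x - int a) * 1] (mod int p)"
      by simp
    moreover have "coprime (int x - int a) (int p)"
    proof -
      have "\<not> int p dvd int x - int a"
        using False assms zdvd_not_zless[of "\<bar>int x - int a\<bar>" "int p"] by auto
      then show ?thesis
        using prime by (simp add: prime_imp_coprime coprime_commute)
    qed
    ultimately have "[int S = 1] (mod int p)"
      by (rule iffD1[OF cong_mult_lcancel, rotated])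
    then have "[S = 1] (mod p)"
      by (metis cong_int_iff of_nat_1)
    then have "[1 + (p - 1) * S = 1 + (p - 1) * 1] (mod p)"
      by (intro cong_add cong_mult cong_refl)
    then show ?thesis
      unfolding sum using False p_gt_1 by (simp add: cong_def)
  qed
qed

lemma interpolation:
  assumes x: "x < p" and y: "y < p"
  shows "[(\<Sum>i<p. \<Sum>j<p. interpolation_coeff p f i j * (x ^ i * y ^ j)) = f x y] (mod p)"
proof -
  let ?B = "basis_coeff p"
  have "[(\<Sum>i<p. \<Sum>j<p. interpolation_coeff p f i j * (x ^ i * y ^ j)) =
      (\<Sum>i<p. \<Sum>j<p. (\<Sum>a<p. \<Sum>b<p. f a b * ?B a i * ?B b j) * (x ^ i * y ^ j))] (mod p)"
    unfolding interpolation_coeff_def by (intro cong_sum cong_mult) (simp_all add: cong_def)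
  also have "(\<Sum>i<p. \<Sum>j<p. (\<Sum>a<p. \<Sum>b<p. f a b * ?B a i * ?B b j) * (x ^ i * y ^ j)) =
      (\<Sum>i<p. \<Sum>j<p. \<Sum>a<p. \<Sum>b<p. f a b * ((?B a i * x ^ i) * (?B b j * y ^ j)))"
    by (simp add: sum_distrib_right sum_distrib_left mult_ac)
  \<comment> \<open>Reordering the sums separates \<open>i\<close> from \<open>j\<close>, so that
    the inner double sum becomes a product of two basis sums.\<close>
  also have "\<dots> = (\<Sum>i<p. \<Sum>a<p. \<Sum>j<p. \<Sum>b<p. f a b * ((?B a i * x ^ i) * (?B b j * y ^ j)))"
    by (intro sum.cong refl sum.swap)
  also have "\<dots> = (\<Sum>a<p. \<Sum>i<p. \<Sum>b<p. \<Sum>j<p. f a b * ((?B a i * x ^ i) * (?B b j * y ^ j)))"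
    by (subst sum.swap) (intro sum.cong refl sum.swap)
  also have "\<dots> = (\<Sum>a<p. \<Sum>b<p. \<Sum>i<p. \<Sum>j<p. f a b * ((?B a i * x ^ i) * (?B b j * y ^ j)))"
    by (intro sum.cong refl sum.swap)
  also have "\<dots> = (\<Sum>a<p. \<Sum>b<p. f a b * ((\<Sum>i<p. ?B a i * x ^ i) * (\<Sum>j<p. ?B b j * y ^ j)))"
    by (simp only: sum_product) (simp only: sum_distrib_left)
  also have "[\<dots> = (\<Sum>a<p. \<Sum>b<p. f a b * (of_bool (x = a) * of_bool (y = b)))] (mod p)"
    by (intro cong_sum cong_mult basis_sum cong_refl) (use x y in auto)
  also have "(\<Sum>a<p. \<Sum>b<p. f a b * (of_bool (x = a) * of_bool (y = b))) =
      (\<Sum>a<p. if a = x then \<Sum>b<p. if b = y then f a b else 0 else 0)"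
    by (intro sum.cong) auto
  also have "\<dots> = f x y"
    using x y by simp
  finally show ?thesis .
qed

lemma poly_function_eq:
  assumes x: "x < p" and y: "y < p"
  shows "poly_function R (presented_poly (prime_instance p f)) x y = f x y mod p"
proof -
  let ?c = "presented_poly (prime_instance p f)"
  let ?S = "{(i, j). ?c i j \<noteq> \<zero>\<^bsub>R\<^esub>}"
  have S: "?S \<subseteq> {..<p} \<times> {..<p}"
    by (auto simp: zero_R presented_poly_eq split: if_splits)
  then have fin: "finite ?S"
    by (rule finite_subset) simp
  have c: "?c i j < p" for i j
    using p_gt_1 interpolation_coeff_less by (simp add: presented_poly_eq)
  have monomial: "?c i j \<otimes>\<^bsub>R\<^esub> (x [^]\<^bsub>R\<^esub> i \<otimes>\<^bsub>R\<^esub> y [^]\<^bsub>R\<^esub> j) = ?c i j * (x ^ i * y ^ j) mod p" for i j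
    using x y c p_gt_1
    by (simp add: nat_pow_R mult_R mod_mult_right_eq) (metis mod_mult_left_eq mod_mult_right_eq)
  have "poly_function R ?c x y = (\<Sum>(i, j)\<in>?S. ?c i j * (x ^ i * y ^ j) mod p) mod p"
    unfolding poly_function_def monomial using fin p_gt_1 by (subst finsum_R) (auto simp: case_prod_unfold)
  also have "\<dots> = (\<Sum>(i, j)\<in>?S. ?c i j * (x ^ i * y ^ j)) mod p"
    by (simp add: case_prod_unfold mod_sum_eq)
  also have "(\<Sum>(i, j)\<in>?S. ?c i j * (x ^ i * y ^ j)) =
      (\<Sum>(i, j)\<in>{..<p} \<times> {..<p}. ?c i j * (x ^ i * y ^ j))"
    using S by (intro sum.mono_neutral_left) (auto simp: zero_R)
  also have "\<dots> = (\<Sum>i<p. \<Sum>j<p. interpolation_coeff p f i j * (x ^ i * y ^ j))"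
    unfolding sum.cartesian_product[symmetric] by (intro sum.cong refl) (simp add: presented_poly_eq)
  finally show ?thesis
    using interpolation[OF x y] by (simp add: cong_def)
qed

section \<open>The development modulo \<open>p\<close>\<close>

lemma development_boundary:
  "development (instance_system (prime_instance p f)) 0 j = 1"
  "development (instance_system (prime_instance p f)) i 0 = 1"
  by (simp, simp add: instance_system_def poly_system_def one_R)
     (cases i, simp_all add: instance_system_def poly_system_def one_R)

lemma development_less: "development (instance_system (prime_instance p f)) i j < p"
proof -
  have *: "double_recursion_system (instance_system (prime_instance p f))"
    by (rule double_recursion_system_instance[OF valid])
  have "development (instance_system (prime_instance p f)) i j \<in> carrier R"
  proof (induction "instance_system (prime_instance p f)" i j rule: development.induct)
    case (3 i j)
    then show ?case
      using * by (simp add: double_recursion_system_def instance_system_def poly_system_def)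
  qed (use p_gt_1 in \<open>simp_all add: instance_system_def poly_system_def one_R carrier_R\<close>)
  then show ?thesis by (simp add: carrier_R)
qed

lemma development_Suc:
  "development (instance_system (prime_instance p f)) (Suc i) (Suc j) =
     f (development (instance_system (prime_instance p f)) i (Suc j))
       (development (instance_system (prime_instance p f)) (Suc i) j) mod p"
proof -
  have "rule (instance_system (prime_instance p f)) x y = f x y mod p" if "x < p" "y < p" for x y
    using poly_function_eq[OF that] by (simp add: instance_system_def poly_system_def)
  then show ?thesis
    by (simp add: development_less)
qed

lemma white_eq: "white (instance_system (prime_instance p f)) = 0"
  by (simp add: instance_system_def poly_system_def zero_R)

end

section \<open>Register programs\<close>

text \<open>
  \<open>Loop r b\<close> decrements register \<open>r\<close> and runs \<open>b\<close>, as long as \<open>r\<close> is positive. The commands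
  \<open>Halt\<close>, \<open>Spin\<close>, \<open>Loop2\<close> and \<open>Begin\<close> only occur as states of the queue machine.
\<close>

datatype com = Skip | Halt | Spin | Inc nat | Seq com com | Loop nat com | Loop2 nat com | Begin com

inductive exec :: "com \<Rightarrow> (nat \<Rightarrow> nat) \<Rightarrow> (nat \<Rightarrow> nat) \<Rightarrow> bool" where
  Skip: "exec Skip s s"
| Inc: "exec (Inc r) s (s(r := Suc (s r)))"
| Seq: "exec c s s' \<Longrightarrow> exec c' s' s'' \<Longrightarrow> exec (Seq c c') s s''"
| Loop_exit: "s r = 0 \<Longrightarrow> exec (Loop r b) s s"
| Loop_iter: "s r = Suc k \<Longrightarrow> exec b (s(r := k)) s' \<Longrightarrow> exec (Loop r b) s' s'' \<Longrightarrow>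
    exec (Loop r b) s s''"

definition clear :: "nat \<Rightarrow> com" where
  "clear r = Loop r Skip"

definition move :: "nat \<Rightarrow> nat \<Rightarrow> com" where
  "move a b = Loop a (Inc b)"

definition copy :: "nat \<Rightarrow> nat \<Rightarrow> nat \<Rightarrow> com" where
  "copy a b c = Seq (Loop a (Seq (Inc b) (Inc c))) (move c a)"

fun clears :: "nat \<Rightarrow> nat \<Rightarrow> com" where
  "clears t 0 = Skip"
| "clears t (Suc m) = Seq (clear t) (clears (Suc t) m)"

text \<open>The programs arrive already compiled, so that \<open>compile\<close> can recurse through
  the list by \<open>map\<close>. The results are put side by side from \<open>t\<close> on.\<close>

fun runs :: "(nat list \<Rightarrow> nat \<Rightarrow> com) list \<Rightarrow> nat list \<Rightarrow> nat \<Rightarrow> com" where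
  "runs [] as t = Skip"
| "runs (h # hs) as t = Seq (h as t) (runs hs as (Suc t))"

text \<open>
  The arguments are in the registers \<open>as\<close>. The result goes to register \<open>t\<close>; the registers
  from \<open>t\<close> on are \<open>0\<close> at the beginning and serve as scratch space, and all registers except \<open>t\<close>
  get their old values back.
\<close>

primrec compile :: "recf \<Rightarrow> nat list \<Rightarrow> nat \<Rightarrow> com" where
  "compile Zero = (\<lambda>as t. Skip)"
| "compile Succ = (\<lambda>as t. Seq (copy (hd as) t (Suc t)) (Inc t))"
| "compile (Proj i) = (\<lambda>as t. copy (as ! i) t (Suc t))"
| "compile (Comp f gs) = (\<lambda>as t.
     Seq (runs (map compile gs) as (Suc t))
    (Seq (compile f [Suc t..<Suc t + length gs] (Suc t + length gs))
    (Seq (clears (Suc t) (length gs)) (move (Suc t + length gs) t))))"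
| "compile (PrimRec f g) = (\<lambda>as t.
     Seq (copy (hd as) (t + 1) (t + 2))
    (Seq (compile f (tl as) (t + 3))
    (Seq (Loop (t + 1)
           (Seq (compile g ((t + 2) # (t + 3) # tl as) (t + 4))
           (Seq (clear (t + 3)) (Seq (move (t + 4) (t + 3)) (Inc (t + 2))))))
    (Seq (clear (t + 2)) (move (t + 3) t)))))"
| "compile (Mu f) = (\<lambda>as t.
     Seq (Inc (t + 1))
    (Loop (t + 1)
      (Seq (compile f (t # as) (t + 2))
      (Loop (t + 2) (Seq (clear (t + 2)) (Seq (Inc t) (Inc (t + 1))))))))"

section \<open>Correctness of the basic programs and of the compiler\<close>

lemma exec_clear: "exec (clear r) s (s(r := 0))"
proof (induction "s r" arbitrary: s)
  case 0
  then have "s(r := 0) = s" by auto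
  then show ?case
    unfolding clear_def using 0 by (metis exec.Loop_exit)
next
  case (Suc k)
  have "exec (clear r) (s(r := k)) (s(r := 0))"
    using Suc(1)[of "s(r := k)"] by simp
  then show ?case
    unfolding clear_def using Suc(2) by (metis exec.Loop_iter exec.Skip)
qed

lemma exec_move: "a \<noteq> b \<Longrightarrow> exec (move a b) s (s(b := s b + s a, a := 0))"
proof (induction "s a" arbitrary: s)
  case 0
  then have "s(b := s b + s a, a := 0) = s" by auto
  then show ?case
    unfolding move_def using 0 by (metis exec.Loop_exit)
next
  case (Suc k)
  let ?s = "s(a := k, b := Suc (s b))"
  have "exec (Inc b) (s(a := k)) ?s"
    using exec.Inc[of b "s(a := k)"] Suc by simp
  moreover have "exec (move a b) ?s (s(b := s b + s a, a := 0))"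
    using Suc(1)[of ?s] Suc(3) by (simp add: fun_upd_twist Suc(2)[symmetric])
  ultimately show ?case
    unfolding move_def using Suc(2) by (metis exec.Loop_iter)
qed

lemma exec_copy_loop:
  assumes "a \<noteq> b" "a \<noteq> c" "b \<noteq> c"
  shows "exec (Loop a (Seq (Inc b) (Inc c))) s (s(b := s b + s a, c := s c + s a, a := 0))"
proof (induction "s a" arbitrary: s)
  case 0
  then have "s(b := s b + s a, c := s c + s a, a := 0) = s" by auto
  then show ?case
    using 0 by (metis exec.Loop_exit)
next
  case (Suc k)
  let ?s = "s(a := k, b := Suc (s b), c := Suc (s c))"
  have "exec (Seq (Inc b) (Inc c)) (s(a := k)) ?s"
    using exec.Seq[OF exec.Inc[of b "s(a := k)"] exec.Inc[of c]] assms by simp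
  moreover have "?s(b := ?s b + ?s a, c := ?s c + ?s a, a := 0) =
      s(b := s b + s a, c := s c + s a, a := 0)"
    using Suc(2) assms by (auto simp: fun_eq_iff)
  then have "exec (Loop a (Seq (Inc b) (Inc c))) ?s (s(b := s b + s a, c := s c + s a, a := 0))"
    using Suc(1)[of ?s] assms by simp
  ultimately show ?case
    using Suc(2) by (metis exec.Loop_iter)
qed

lemma exec_copy:
  assumes "a \<noteq> b" "a \<noteq> c" "b \<noteq> c" "s c = 0"
  shows "exec (copy a b c) s (s(b := s b + s a))"
proof -
  let ?s = "s(b := s b + s a, c := s c + s a, a := 0)"
  have "?s(a := ?s a + ?s c, c := 0) = s(b := s b + s a)"
    using assms by (auto simp: fun_eq_iff)
  with exec_move[of c a ?s] assms have "exec (move c a) ?s (s(b := s b + s a))"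
    by simp
  with exec_copy_loop[OF assms(1-3)] show ?thesis
    unfolding copy_def by (rule exec.Seq)
qed

lemma exec_clears: "exec (clears t m) s (\<lambda>r. if t \<le> r \<and> r < t + m then 0 else s r)"
proof (induction m arbitrary: t s)
  case 0
  have "(\<lambda>r. if t \<le> r \<and> r < t + 0 then 0 else s r) = s" by auto
  then show ?case by (simp only: clears.simps exec.Skip)
next
  case (Suc m)
  have "(\<lambda>r. if Suc t \<le> r \<and> r < Suc t + m then 0 else (s(t := 0)) r) =
      (\<lambda>r. if t \<le> r \<and> r < t + Suc m then 0 else s r)"
    by (auto simp: fun_eq_iff)
  with exec.Seq[OF exec_clear Suc[of "Suc t" "s(t := 0)"]] show ?case by simp
qed

text \<open>The final state \<open>s(t := y)\<close> says that the arguments are intact and the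
  scratch registers are 0 again, which allows programs to be chained.\<close>

definition correct :: "recf \<Rightarrow> bool" where
  "correct f \<longleftrightarrow> (\<forall>as t s y. computes f (map s as) y \<longrightarrow> (\<forall>a\<in>set as. a < t) \<longrightarrow>
     (\<forall>r\<ge>t. s r = 0) \<longrightarrow> exec (compile f as t) s (s(t := y)))"

lemma correctD:
  "correct f \<Longrightarrow> computes f (map s as) y \<Longrightarrow> (\<And>a. a \<in> set as \<Longrightarrow> a < t) \<Longrightarrow>
     (\<And>r. t \<le> r \<Longrightarrow> s r = 0) \<Longrightarrow> exec (compile f as t) s (s(t := y))"
  by (simp add: correct_def)

text \<open>Induction over the list with \<open>t\<close> and \<open>s\<close> arbitrary: results go
  to \<open>t\<close> and above, arguments lie below, so each program still sees the original
  arguments and zeros from its own target on.\<close>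

lemma exec_runs:
  assumes "list_all2 (\<lambda>g y. computes g xs y) gs ys" "map s as = xs"
    and "\<And>g. g \<in> set gs \<Longrightarrow> correct g"
    and "\<And>a. a \<in> set as \<Longrightarrow> a < t" "\<And>r. t \<le> r \<Longrightarrow> s r = 0"
  shows "exec (runs (map compile gs) as t) s
    (\<lambda>r. if t \<le> r \<and> r < t + length gs then ys ! (r - t) else s r)"
  using assms
proof (induction gs ys arbitrary: t s rule: list_all2_induct)
  case Nil
  have "(\<lambda>r. if t \<le> r \<and> r < t then v r else s r) = s" for v by auto
  then show ?case by (simp add: exec.Skip)
next
  case (Cons g gs y ys)
  let ?s = "s(t := y)"
  have "exec (compile g as t) s ?s"
    using Cons by (intro correctD) simp_all
  moreover have "exec (runs (map compile gs) as (Suc t)) ?s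
    (\<lambda>r. if Suc t \<le> r \<and> r < Suc t + length gs then ys ! (r - Suc t) else ?s r)"
  proof (rule Cons.IH)
    show "map ?s as = xs"
      using Cons.prems(1,3) by fastforce
  qed (use Cons.prems in \<open>simp_all add: less_SucI\<close>)
  moreover have "(\<lambda>r. if Suc t \<le> r \<and> r < Suc t + length gs then ys ! (r - Suc t) else ?s r) =
    (\<lambda>r. if t \<le> r \<and> r < t + length (g # gs) then (y # ys) ! (r - t) else s r)"
    by (auto simp: fun_eq_iff nth_Cons')
  ultimately show ?case
    unfolding list.map runs.simps by (simp only: exec.Seq)
qed

lemma correct_Comp:
  assumes f: "correct f" and gs: "\<And>g. g \<in> set gs \<Longrightarrow> correct g"
  shows "correct (Comp f gs)"
  unfolding correct_def
proof (intro allI impI)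
  fix as :: "nat list" and t :: nat and s :: "nat \<Rightarrow> nat" and y
  assume c: "computes (Comp f gs) (map s as) y" and as: "\<forall>a\<in>set as. a < t"
    and s: "\<forall>r\<ge>t. s r = 0"
  from c obtain ys where ys: "list_all2 (\<lambda>g. computes g (map s as)) gs ys" "computes f ys y"
    by (rule computes_CompE)
  let ?m = "length gs"
  let ?u = "Suc t + ?m"
  \<comment> \<open>The states after evaluating \<open>gs\<close>, after running \<open>f\<close> on
    these values, and after clearing them.\<close>
  define s1 where "s1 = (\<lambda>r. if Suc t \<le> r \<and> r < ?u then ys ! (r - Suc t) else s r)"
  define s2 where "s2 = s1(?u := y)"
  define s3 where "s3 = (\<lambda>r. if Suc t \<le> r \<and> r < ?u then 0 else s2 r)"
  have "exec (runs (map compile gs) as (Suc t)) s s1"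
    unfolding s1_def by (rule exec_runs[OF ys(1) refl gs]) (use as s in \<open>simp_all add: less_SucI\<close>)
  moreover have "map s1 [Suc t..<?u] = ys"
  proof (rule nth_equalityI)
    show "length (map s1 [Suc t..<?u]) = length ys"
      using list_all2_lengthD[OF ys(1)] by (simp del: upt_Suc)
    show "map s1 [Suc t..<?u] ! i = ys ! i" if "i < length (map s1 [Suc t..<?u])" for i
    proof -
      have "i < length gs"
        using that by (simp del: upt_Suc)
      then show ?thesis
        by (simp add: s1_def nth_upt del: upt_Suc)
    qed
  qed
  with ys(2) have "computes f (map s1 [Suc t..<?u]) y" by (simp only:)
  then have "exec (compile f [Suc t..<?u] ?u) s1 s2"
    unfolding s2_def
  proof (rule correctD[OF f])
    show "s1 r = 0" if "?u \<le> r" for r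
      using that s by (simp add: s1_def)
  qed (simp del: upt_Suc)
  moreover have "exec (clears (Suc t) ?m) s2 s3"
    unfolding s3_def by (rule exec_clears)
  moreover have "s3(t := s3 t + s3 ?u, ?u := 0) = s(t := y)"
    using s by (auto simp: s3_def s2_def s1_def fun_eq_iff)
  then have "exec (move ?u t) s3 (s(t := y))"
    using exec_move[of ?u t s3] by simp
  ultimately show "exec (compile (Comp f gs) as t) s (s(t := y))"
    unfolding compile.simps by (intro exec.Seq)
qed

text \<open>The compiled loop counts upwards from 0, whereas \<open>computes\<close> unfolds
  downwards from \<open>n\<close>; the sequence \<open>v\<close> of intermediate values
  mediates.\<close>

lemma computes_PrimRec_values:
  assumes "computes (PrimRec f g) (n # xs) y"
  obtains v where "computes f xs (v 0)" "\<And>i. i < n \<Longrightarrow> computes g (i # v i # xs) (v (Suc i))"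
    "v n = y"
proof -
  have "\<exists>v. computes f xs (v 0) \<and> (\<forall>i<n. computes g (i # v i # xs) (v (Suc i))) \<and> v n = y"
    using assms
  proof (induction n arbitrary: y)
    case 0
    then have "computes f xs y" by (rule computes_PrimRec_0E)
    then show ?case by (intro exI[of _ "\<lambda>_. y"]) simp
  next
    case (Suc n)
    from Suc.prems obtain r where r: "computes (PrimRec f g) (n # xs) r" "computes g (n # r # xs) y"
      by (rule computes_PrimRec_SucE)
    from Suc.IH[OF r(1)] obtain v where v: "computes f xs (v 0)"
      "\<forall>i<n. computes g (i # v i # xs) (v (Suc i))" "v n = r" by blast
    show ?case
      using v r(2) by (intro exI[of _ "v(Suc n := y)"]) (auto simp: less_Suc_eq)
  qed
  then show ?thesis using that by blast
qed

lemma correct_PrimRec: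
  assumes f: "correct f" and g: "correct g"
  shows "correct (PrimRec f g)"
  unfolding correct_def
proof (intro allI impI)
  fix as :: "nat list" and t :: nat and s :: "nat \<Rightarrow> nat" and y
  assume c: "computes (PrimRec f g) (map s as) y" and as: "\<forall>a\<in>set as. a < t"
    and s: "\<forall>r\<ge>t. s r = 0"
  have "as \<noteq> []"
  proof
    assume "as = []"
    with c have "computes (PrimRec f g) [] y" by simp
    then show False by cases
  qed
  then obtain a bs where ab: "as = a # bs"
    by (cases as) auto
  define n where "n = s a"
  define xs where "xs = map s bs"
  have "computes (PrimRec f g) (n # xs) y"
    using c by (simp add: ab n_def xs_def)
  then obtain v where v: "computes f xs (v 0)"
      "\<And>i. i < n \<Longrightarrow> computes g (i # v i # xs) (v (Suc i))" "v n = y"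
    by (rule computes_PrimRec_values) blast
  \<comment> \<open>The state after \<open>i\<close> rounds: rounds left, rounds done, current
    value.\<close>
  define S where "S = (\<lambda>i. s(t + 1 := n - i, t + 2 := i, t + 3 := v i))"
  have bs: "\<And>b. b \<in> set bs \<Longrightarrow> b < t" and a: "a < t"
    using as by (auto simp: ab)
  have bs_add: "\<And>b k. b \<in> set bs \<Longrightarrow> b < t + k"
    using bs by (simp add: trans_less_add1)
  have map_bs: "map s' bs = xs" if "\<And>r. r < t \<Longrightarrow> s' r = s r" for s'
    using bs that by (simp add: xs_def)
  let ?body = "Seq (compile g ((t + 2) # (t + 3) # bs) (t + 4))
           (Seq (clear (t + 3)) (Seq (move (t + 4) (t + 3)) (Inc (t + 2))))"
  have body: "exec ?body ((S i)(t + 1 := n - Suc i)) (S (Suc i))" if "i < n" for i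
  proof -
    let ?s1 = "(S i)(t + 1 := n - Suc i)"
    let ?s2 = "?s1(t + 4 := v (Suc i))"
    let ?s3 = "?s2(t + 3 := 0)"
    let ?s4 = "?s3(t + 3 := ?s3 (t + 3) + ?s3 (t + 4), t + 4 := 0)"
    have "map ?s1 ((t + 2) # (t + 3) # bs) = i # v i # xs"
      using map_bs[of ?s1] by (simp add: S_def)
    then have "exec (compile g ((t + 2) # (t + 3) # bs) (t + 4)) ?s1 ?s2"
      using v(2)[OF that] s by (intro correctD[OF g]) (auto simp: S_def bs_add)
    moreover have "exec (clear (t + 3)) ?s2 ?s3"
      by (rule exec_clear)
    moreover have "exec (move (t + 4) (t + 3)) ?s3 ?s4"
      by (rule exec_move) simp
    moreover have "?s4(t + 2 := Suc (?s4 (t + 2))) = S (Suc i)"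
      using s by (auto simp: S_def fun_eq_iff)
    with exec.Inc[of "t + 2" ?s4] have "exec (Inc (t + 2)) ?s4 (S (Suc i))" by simp
    ultimately show ?thesis by (intro exec.Seq)
  qed
  have loop: "exec (Loop (t + 1) ?body) (S i) (S n)" if "i \<le> n" for i
    using that
  proof (induction rule: inc_induct)
    case base
    then show ?case by (rule exec.Loop_exit) (simp add: S_def)
  next
    case (step i)
    have "S i (t + 1) = Suc (n - Suc i)"
      using step.hyps by (simp add: S_def)
    from exec.Loop_iter[where b = ?body, OF this body[OF step.hyps(2)] step.IH] show ?case .
  qed
  have "exec (copy a (t + 1) (t + 2)) s (s(t + 1 := s (t + 1) + s a))"
    using a s by (intro exec_copy) auto
  moreover have "s(t + 1 := s (t + 1) + s a) = s(t + 1 := n)"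
    using s by (simp add: n_def)
  ultimately have 1: "exec (copy a (t + 1) (t + 2)) s (s(t + 1 := n))"
    by (simp only:)
  have "exec (compile f bs (t + 3)) (s(t + 1 := n)) (s(t + 1 := n, t + 3 := v 0))"
    using v(1) s map_bs[of "s(t + 1 := n)"] by (intro correctD[OF f]) (auto simp: bs_add)
  moreover have "s(t + 1 := n, t + 3 := v 0) = S 0"
    using s by (auto simp: S_def fun_eq_iff)
  ultimately have 2: "exec (compile f bs (t + 3)) (s(t + 1 := n)) (S 0)"
    by (simp only:)
  have "((S n)(t + 2 := 0))(t := ((S n)(t + 2 := 0)) t + ((S n)(t + 2 := 0)) (t + 3), t + 3 := 0)
      = s(t := y)"
    using s v(3) by (auto simp: S_def fun_eq_iff)
  moreover have "exec (move (t + 3) t) ((S n)(t + 2 := 0))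
      (((S n)(t + 2 := 0))(t := ((S n)(t + 2 := 0)) t + ((S n)(t + 2 := 0)) (t + 3), t + 3 := 0))"
    by (rule exec_move) simp
  ultimately have 3: "exec (move (t + 3) t) ((S n)(t + 2 := 0)) (s(t := y))"
    by (simp only:)
  show "exec (compile (PrimRec f g) as t) s (s(t := y))"
    unfolding compile.simps ab list.sel
    by (rule exec.Seq[OF 1 exec.Seq[OF 2 exec.Seq[OF loop[OF le0] exec.Seq[OF exec_clear 3]]]])
qed

lemma correct_Mu:
  assumes f: "correct f"
  shows "correct (Mu f)"
  unfolding correct_def
proof (intro allI impI)
  fix as :: "nat list" and t :: nat and s :: "nat \<Rightarrow> nat" and n
  assume c: "computes (Mu f) (map s as) n" and as: "\<forall>a\<in>set as. a < t"
    and s: "\<forall>r\<ge>t. s r = 0"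
  have c0: "computes f (n # map s as) 0" and c1: "\<And>m. m < n \<Longrightarrow> \<exists>y. computes f (m # map s as) (Suc y)"
    by (rule computes_MuE[OF c], simp)+
  \<comment> \<open>A conditional: the loop clears its own register, so its body runs at most once.
    Register \<open>t\<close> holds the candidate, \<open>t + 1\<close> is the flag for a further
    round.\<close>
  let ?test = "Loop (t + 2) (Seq (clear (t + 2)) (Seq (Inc t) (Inc (t + 1))))"
  let ?body = "Seq (compile f (t # as) (t + 2)) ?test"
  have run: "exec (compile f (t # as) (t + 2)) (s(t := i)) (s(t := i, t + 2 := y))"
    if "computes f (i # map s as) y" for i y
  proof (rule correctD[OF f])
    have "map (s(t := i)) as = map s as"
      using as by auto
    with that show "computes f (map (s(t := i)) (t # as)) y"
      by (simp only: list.map fun_upd_same)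
  qed (use as s in auto)
  have Loop_once: "exec (Loop (t + 1) b) (s(t := i, t + 1 := 1)) s''"
    if "exec b (s(t := i)) s'" "s(t := i, t + 1 := 0) = s(t := i)" "exec (Loop (t + 1) b) s' s''"
    for i b s' s''
  proof -
    have "(s(t := i, t + 1 := 1)) (t + 1) = Suc 0" by simp
    moreover have "exec b ((s(t := i, t + 1 := 1))(t + 1 := 0)) s'"
      unfolding fun_upd_upd that(2) by (rule that(1))
    ultimately show ?thesis
      using that(3) by (rule exec.Loop_iter)
  qed
  have loop: "exec (Loop (t + 1) ?body) (s(t := i, t + 1 := 1)) (s(t := n))" if "i \<le> n" for i
    using that
  proof (induction rule: inc_induct)
    case base
    have e: "s(t := n, t + 2 := 0) = s(t := n)" "s(t := n, t + 1 := 0) = s(t := n)"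
      using s by (auto simp: fun_eq_iff)
    have "exec ?test (s(t := n)) (s(t := n))"
      using s by (intro exec.Loop_exit) simp
    with run[OF c0] have "exec ?body (s(t := n)) (s(t := n))"
      unfolding e by (rule exec.Seq)
    moreover have "exec (Loop (t + 1) ?body) (s(t := n)) (s(t := n))"
      using s by (intro exec.Loop_exit) simp
    ultimately show ?case
      using e(2) by (intro Loop_once)
  next
    case (step i)
    obtain y where y: "computes f (i # map s as) (Suc y)"
      using c1 step.hyps by blast
    let ?s1 = "s(t := i, t + 2 := y)"
    let ?s2 = "?s1(t + 2 := 0)"
    let ?s3 = "?s2(t := Suc (?s2 t))"
    let ?s4 = "?s3(t + 1 := Suc (?s3 (t + 1)))"
    have e: "?s4 = s(t := Suc i, t + 1 := 1)"
      using s by (auto simp: fun_eq_iff)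
    have "exec (Seq (clear (t + 2)) (Seq (Inc t) (Inc (t + 1)))) ?s1 ?s4"
      by (intro exec.Seq[OF exec_clear] exec.Seq[OF exec.Inc] exec.Inc)
    then have test_body: "exec (Seq (clear (t + 2)) (Seq (Inc t) (Inc (t + 1))))
        ((s(t := i, t + 2 := Suc y))(t + 2 := y)) (s(t := Suc i, t + 1 := 1))"
      unfolding e unfolding fun_upd_upd .
    have "exec ?test (s(t := Suc i, t + 1 := 1)) (s(t := Suc i, t + 1 := 1))"
      using s by (intro exec.Loop_exit) simp
    with test_body have "exec ?test (s(t := i, t + 2 := Suc y)) (s(t := Suc i, t + 1 := 1))"
      by (rule exec.Loop_iter[rotated]) simp
    with run[OF y] have "exec ?body (s(t := i)) (s(t := Suc i, t + 1 := 1))"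
      by (rule exec.Seq)
    moreover have "s(t := i, t + 1 := 0) = s(t := i)"
      using s by (auto simp: fun_eq_iff)
    ultimately show ?case
      using step.IH by (intro Loop_once)
  qed
  have "s(t + 1 := Suc (s (t + 1))) = s(t := 0, t + 1 := 1)"
    using s by (auto simp: fun_eq_iff)
  with exec.Inc[of "t + 1" s] have "exec (Inc (t + 1)) s (s(t := 0, t + 1 := 1))"
    by simp
  from exec.Seq[OF this loop[OF le0]] show "exec (compile (Mu f) as t) s (s(t := n))"
    by simp
qed

lemma correct_compile: "correct f"
proof (induction f)
  case Zero
  have "exec Skip s (s(t := y))" if "computes Zero xs y" "\<forall>r\<ge>t. s r = 0" for xs y t s
  proof -
    from that(1) have "y = 0" by (rule computes_ZeroE)
    with that(2) have "s(t := y) = s" by auto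
    then show ?thesis by (simp add: exec.Skip)
  qed
  then show ?case by (auto simp: correct_def)
next
  case Succ
  have "exec (compile Succ as t) s (s(t := y))"
    if "computes Succ (map s as) y" "\<forall>a\<in>set as. a < t" "\<forall>r\<ge>t. s r = 0" for as y t s
  proof -
    from that(1) obtain a where a: "as = [a]" "y = Suc (s a)" by (auto elim!: computes_SuccE)
    have "exec (copy a t (Suc t)) s (s(t := s t + s a))"
      using that a by (intro exec_copy) auto
    from exec.Seq[OF this exec.Inc[of t]] show ?thesis
      using that a by simp
  qed
  then show ?case by (auto simp: correct_def)
next
  case (Proj i)
  have "exec (compile (Proj i) as t) s (s(t := y))"
    if "computes (Proj i) (map s as) y" "\<forall>a\<in>set as. a < t" "\<forall>r\<ge>t. s r = 0" for as y t s
  proof -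
    from that(1) have a: "i < length as" "y = s (as ! i)" by (auto elim!: computes_ProjE)
    with that(2) have "as ! i < t" by simp
    then have "exec (copy (as ! i) t (Suc t)) s (s(t := s t + s (as ! i)))"
      using that by (intro exec_copy) auto
    then show ?thesis
      using that a by simp
  qed
  then show ?case by (auto simp: correct_def)
qed (simp_all add: correct_Comp correct_PrimRec correct_Mu)

section \<open>The queue machine\<close>

text \<open>Cells contain commands and will be numbered by \<open>to_nat\<close>.\<close>

instance com :: countable
  by countable_datatype

text \<open>
  The value of register \<open>r\<close> is the number of letters \<open>Suc r\<close> in the queue; the letter \<open>0\<close>
  occurs once. A register is known to be \<open>0\<close> when its letter has not been seen between two
  occurrences of \<open>0\<close>, which is why loops have a second state \<open>Loop2\<close>.
\<close>

fun delta :: "com \<Rightarrow> nat \<Rightarrow> com \<times> nat list" where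
  "delta Skip a = (Halt, [])"
| "delta Halt a = (Halt, [])"
| "delta Spin a = (Spin, [a])"
| "delta (Inc r) a = (Skip, [a, Suc r])"
| "delta (Seq c c') a =
     (if c = Skip then (c', [a]) else (Seq (fst (delta c a)) c', snd (delta c a)))"
| "delta (Loop r b) a =
     (if a = Suc r then (Seq b (Loop r b), [])
      else (if a = 0 then Loop2 r b else Loop r b, [a]))"
| "delta (Loop2 r b) a =
     (if a = Suc r then (Seq b (Loop r b), [])
      else (if a = 0 then Skip else Loop2 r b, [a]))"
| "delta (Begin c) a = (c, [0])"

text \<open>\<open>Skip\<close> is excluded because it marks the end of the first part of a
  \<open>Seq\<close>, so that runs lift to \<open>Seq\<close>; \<open>Halt\<close> because it turns
  into white cells in the simulation.\<close>

inductive step :: "com \<times> nat list \<Rightarrow> com \<times> nat list \<Rightarrow> bool" where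
  "c \<noteq> Skip \<Longrightarrow> c \<noteq> Halt \<Longrightarrow> step (c, a # w) (fst (delta c a), w @ snd (delta c a))"

definition holds :: "nat list \<Rightarrow> (nat \<Rightarrow> nat) \<Rightarrow> bool" where
  "holds w s \<longleftrightarrow> count_list w 0 = 1 \<and> (\<forall>r. count_list w (Suc r) = s r)"

lemma holds_zero: "holds w s \<Longrightarrow> count_list w 0 = 1"
  and holds_Suc: "holds w s \<Longrightarrow> count_list w (Suc r) = s r"
  by (simp_all add: holds_def)

lemma holds_not_Nil: "holds w s \<Longrightarrow> w \<noteq> []"
  by (auto simp: holds_def)

lemma holds_append_commute: "holds (u @ v) s \<Longrightarrow> holds (v @ u) s"
  by (simp add: holds_def add.commute)

lemma holds_increment:
  assumes "holds (a # w) s"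
  shows "holds (w @ [a, Suc r]) (s(r := Suc (s r)))"
  unfolding holds_def
proof (intro conjI allI)
  show "count_list (w @ [a, Suc r]) 0 = 1"
    using holds_zero[OF assms] by (simp split: if_splits)
  show "count_list (w @ [a, Suc r]) (Suc q) = (s(r := Suc (s r))) q" for q
    using holds_Suc[OF assms, of q] by (cases "q = r") (simp_all split: if_splits)
qed

lemma holds_delete:
  assumes "holds (u @ Suc r # v) s" "s r = Suc k"
  shows "holds (v @ u) (s(r := k))"
  unfolding holds_def
proof (intro conjI allI)
  show "count_list (v @ u) 0 = 1"
    using holds_zero[OF assms(1)] by simp
  show "count_list (v @ u) (Suc q) = (s(r := k)) q" for q
    using holds_Suc[OF assms(1), of q] assms(2) by (simp split: if_splits)
qed

section \<open>Runs of the queue machine\<close>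

lemma steps_Seq:
  "step\<^sup>*\<^sup>* (c, w) (c', w') \<Longrightarrow> step\<^sup>*\<^sup>* (Seq c d, w) (Seq c' d, w')"
proof (induction rule: rtranclp_induct2)
  case (step c1 w1 c2 w2)
  from step.hyps(2) have "step (Seq c1 d, w1) (Seq c2 d, w2)"
  proof cases
    case (1 a w)
    then show ?thesis
      using step.intros[of "Seq c1 d" a w] by simp
  qed
  with step.IH show ?case by simp
qed simp

lemma steps_rotate:
  assumes "\<And>a. a \<in> set v \<Longrightarrow> delta c a = (c, [a])" "c \<noteq> Skip" "c \<noteq> Halt"
  shows "step\<^sup>*\<^sup>* (c, v @ w) (c, w @ v)"
  using assms(1)
proof (induction v arbitrary: w)
  case (Cons a v)
  have "step (c, a # v @ w) (c, (v @ w) @ [a])"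
    using step.intros[OF assms(2,3), of a "v @ w"] Cons.prems by simp
  also have "step\<^sup>*\<^sup>* (c, (v @ w) @ [a]) (c, (w @ [a]) @ v)"
    using Cons.IH[of "w @ [a]"] Cons.prems by simp
  finally show ?case by simp
qed simp

text \<open>The first 0 switches to \<open>Loop2\<close>; the full round that follows meets no
  letter \<open>Suc r\<close>, so the next 0 ends the loop.\<close>

lemma steps_Loop_exit:
  assumes "holds w s" "s r = 0"
  obtains w' where "step\<^sup>*\<^sup>* (Loop r b, w) (Skip, w')" "holds w' s"
proof -
  have h: "count_list w 0 = 1" "count_list w (Suc r) = 0"
    using holds_zero[OF assms(1)] holds_Suc[OF assms(1), of r] assms(2) by simp_all
  have r: "Suc r \<notin> set w"
    using h(2) by (simp only: count_list_0_iff not_False_eq_True)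
  have "0 \<in> set w"
    using h(1) count_notin[of 0 w] by fastforce
  then obtain u v where w: "w = u @ 0 # v" "0 \<notin> set u"
    by (meson split_list_first)
  have v: "0 \<notin> set v"
    using h(1) by (simp add: w count_list_0_iff)
  have rotate: "delta (Loop r b) a = (Loop r b, [a])" if "a \<in> set u" for a
  proof -
    have "a \<noteq> 0" "a \<noteq> Suc r"
      using that r w by ((intro notI; auto)+)
    then show ?thesis by simp
  qed
  have rotate2: "delta (Loop2 r b) a = (Loop2 r b, [a])" if "a \<in> set (v @ u)" for a
  proof -
    have "a \<noteq> 0" "a \<noteq> Suc r"
      using that r w v by ((intro notI; auto)+)
    then show ?thesis by simp
  qed
  have 1: "step\<^sup>*\<^sup>* (Loop r b, w) (Loop r b, 0 # v @ u)"
    using steps_rotate[of u "Loop r b" "0 # v", OF rotate] by (simp add: w(1))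
  have 2: "step (Loop r b, 0 # v @ u) (Loop2 r b, v @ u @ [0])"
    using step.intros[of "Loop r b" 0 "v @ u"] by simp
  have 3: "step\<^sup>*\<^sup>* (Loop2 r b, v @ u @ [0]) (Loop2 r b, 0 # v @ u)"
    using steps_rotate[of "v @ u" "Loop2 r b" "[0]", OF rotate2] by simp
  have 4: "step (Loop2 r b, 0 # v @ u) (Skip, v @ u @ [0])"
    using step.intros[of "Loop2 r b" 0 "v @ u"] by simp
  have "step\<^sup>*\<^sup>* (Loop r b, w) (Skip, v @ u @ [0])"
    by (rule rtranclp.rtrancl_into_rtrancl[OF rtranclp_trans[OF rtranclp.rtrancl_into_rtrancl[OF 1 2] 3] 4])
  moreover have "holds (v @ u @ [0]) s"
    using holds_append_commute[of u "0 # v" s] holds_append_commute[of "[0]" "v @ u" s] assms(1)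
    by (simp add: w(1))
  ultimately show ?thesis using that by blast
qed

text \<open>The first letter \<open>Suc r\<close> is deleted in either state. At most one 0 precedes
  it, as the queue contains 0 only once, so \<open>Loop2\<close> has not given up before.\<close>

lemma steps_Loop_iter:
  assumes "holds w s" "s r = Suc k"
  obtains w' where "step\<^sup>*\<^sup>* (Loop r b, w) (Seq b (Loop r b), w')" "holds w' (s(r := k))"
proof -
  have h: "count_list w 0 = 1" "count_list w (Suc r) = Suc k"
    using holds_zero[OF assms(1)] holds_Suc[OF assms(1), of r] assms(2) by simp_all
  have "Suc r \<in> set w"
    using h(2) count_notin[of "Suc r" w] by fastforce
  then obtain u v where w: "w = u @ Suc r # v" "Suc r \<notin> set u"
    by (meson split_list_first)
  have hv: "holds (v @ u) (s(r := k))"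
    using holds_delete assms unfolding w(1) .
  have delete: "step (d, Suc r # x) (Seq b (Loop r b), x)" if "d \<in> {Loop r b, Loop2 r b}" for d x
    using that step.intros[of d "Suc r" x] by auto
  show ?thesis
  proof (cases "0 \<in> set u")
    case False
    have rotate: "delta (Loop r b) a = (Loop r b, [a])" if "a \<in> set u" for a
    proof -
      have "a \<noteq> 0" "a \<noteq> Suc r"
        using that w(2) False by ((intro notI; auto)+)
      then show ?thesis by simp
    qed
    have "step\<^sup>*\<^sup>* (Loop r b, w) (Loop r b, Suc r # v @ u)"
      using steps_rotate[of u "Loop r b" "Suc r # v", OF rotate] by (simp add: w(1))
    moreover have "step (Loop r b, Suc r # v @ u) (Seq b (Loop r b), v @ u)"
      by (rule delete) simp
    ultimately have "step\<^sup>*\<^sup>* (Loop r b, w) (Seq b (Loop r b), v @ u)"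
      by (rule rtranclp.rtrancl_into_rtrancl)
    then show ?thesis
      using hv by (rule that)
  next
    case True
    then obtain u1 u2 where u: "u = u1 @ 0 # u2" "0 \<notin> set u1"
      by (meson split_list_first)
    have u2: "0 \<notin> set u2"
      using h(1) by (simp add: w u count_list_0_iff)
    have rotate: "delta (Loop r b) a = (Loop r b, [a])" if "a \<in> set u1" for a
    proof -
      have "a \<noteq> 0" "a \<noteq> Suc r"
        using that w(2) u by ((intro notI; auto)+)
      then show ?thesis by simp
    qed
    have rotate2: "delta (Loop2 r b) a = (Loop2 r b, [a])" if "a \<in> set u2" for a
    proof -
      have "a \<noteq> 0" "a \<noteq> Suc r"
        using that w(2) u u2 by ((intro notI; auto)+)
      then show ?thesis by simp
    qed
    have 1: "step\<^sup>*\<^sup>* (Loop r b, w) (Loop r b, 0 # u2 @ Suc r # v @ u1)"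
      using steps_rotate[of u1 "Loop r b" "0 # u2 @ Suc r # v", OF rotate] by (simp add: w(1) u(1))
    have 2: "step (Loop r b, 0 # u2 @ Suc r # v @ u1) (Loop2 r b, u2 @ Suc r # v @ u1 @ [0])"
      using step.intros[of "Loop r b" 0 "u2 @ Suc r # v @ u1"] by simp
    have 3: "step\<^sup>*\<^sup>* (Loop2 r b, u2 @ Suc r # v @ u1 @ [0]) (Loop2 r b, Suc r # v @ u)"
      using steps_rotate[of u2 "Loop2 r b" "Suc r # v @ u1 @ [0]", OF rotate2] by (simp add: u(1))
    have 4: "step (Loop2 r b, Suc r # v @ u) (Seq b (Loop r b), v @ u)"
      by (rule delete) simp
    have "step\<^sup>*\<^sup>* (Loop r b, w) (Seq b (Loop r b), v @ u)"
      by (rule rtranclp.rtrancl_into_rtrancl[OF rtranclp_trans[OF rtranclp.rtrancl_into_rtrancl[OF 1 2] 3] 4])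
    then show ?thesis
      using hv by (rule that)
  qed
qed

lemma steps_exec:
  assumes "exec c s s'" "holds w s"
  obtains w' where "step\<^sup>*\<^sup>* (c, w) (Skip, w')" "holds w' s'"
proof -
  have "\<exists>w'. step\<^sup>*\<^sup>* (c, w) (Skip, w') \<and> holds w' s'"
    using assms
  proof (induction arbitrary: w rule: exec.induct)
    case (Skip s)
    then show ?case by auto
  next
    case (Inc r s)
    then have "w \<noteq> []" by (rule holds_not_Nil)
    then obtain a v where w: "w = a # v" by (cases w) auto
    have "step (Inc r, w) (Skip, v @ [a, Suc r])"
      using step.intros[of "Inc r" a v] by (simp add: w)
    moreover have "holds (v @ [a, Suc r]) (s(r := Suc (s r)))"
      using Inc holds_increment by (simp add: w)
    ultimately show ?case by blast
  next
    case (Seq c s s' c' s'')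
    obtain w1 where w1: "step\<^sup>*\<^sup>* (c, w) (Skip, w1)" "holds w1 s'"
      using Seq.IH(1)[OF Seq.prems] by blast
    then have "w1 \<noteq> []" by (simp add: holds_not_Nil)
    then obtain a v where v: "w1 = a # v" by (cases w1) auto
    \<comment> \<open>Leaving \<open>Seq Skip c'\<close> costs a step, which rotates the queue by
      one letter.\<close>
    have "holds (v @ [a]) s'"
      using holds_append_commute[of "[a]" v] w1(2) by (simp add: v)
    then obtain w2 where w2: "step\<^sup>*\<^sup>* (c', v @ [a]) (Skip, w2)" "holds w2 s''"
      using Seq.IH(2) by blast
    have "step\<^sup>*\<^sup>* (Seq c c', w) (Seq Skip c', w1)"
      by (rule steps_Seq) (rule w1)
    also have "step (Seq Skip c', w1) (c', v @ [a])"
      using step.intros[of "Seq Skip c'" a v] by (simp add: v)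
    also note w2(1)
    finally show ?case using w2(2) by blast
  next
    case (Loop_exit s r b)
    then show ?case by (meson steps_Loop_exit)
  next
    case (Loop_iter s r k b s' s'')
    obtain w0 where w0: "step\<^sup>*\<^sup>* (Loop r b, w) (Seq b (Loop r b), w0)" "holds w0 (s(r := k))"
      using Loop_iter.prems Loop_iter.hyps(1) by (rule steps_Loop_iter)
    obtain w1 where w1: "step\<^sup>*\<^sup>* (b, w0) (Skip, w1)" "holds w1 s'"
      using Loop_iter.IH(1)[OF w0(2)] by blast
    then have "w1 \<noteq> []" by (simp add: holds_not_Nil)
    then obtain a v where v: "w1 = a # v" by (cases w1) auto
    have "holds (v @ [a]) s'"
      using holds_append_commute[of "[a]" v] w1(2) by (simp add: v)
    then obtain w2 where w2: "step\<^sup>*\<^sup>* (Loop r b, v @ [a]) (Skip, w2)" "holds w2 s''"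
      using Loop_iter.IH(2) by blast
    note w0(1)
    also have "step\<^sup>*\<^sup>* (Seq b (Loop r b), w0) (Seq Skip (Loop r b), w1)"
      by (rule steps_Seq) (rule w1)
    also have "step (Seq Skip (Loop r b), w1) (Loop r b, v @ [a])"
      using step.intros[of "Seq Skip (Loop r b)" a v] by (simp add: v)
    also note w2(1)
    finally show ?case using w2(2) by blast
  qed
  with that show ?thesis by blast
qed

lemma count_list_replicate: "count_list (replicate n a) x = (if x = a then n else 0)"
  by (induction n) auto

text \<open>\<open>Begin\<close> replaces one of the \<open>n + 1\<close> letters 1 by the marker 0,
  which leaves \<open>n\<close> in register 0. The final \<open>Loop 1 Spin\<close> turns the result
  0 into halting and any positive result into spinning.\<close>

lemma steps_recf:
  assumes "computes f [n] y"
  defines "c \<equiv> Seq (compile f [0] 1) (Loop 1 Spin)"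
  obtains w where "w \<noteq> []" "y = 0" "step\<^sup>*\<^sup>* (Begin c, replicate (Suc n) 1) (Skip, w)"
  | w where "w \<noteq> []" "y > 0"
      "step\<^sup>*\<^sup>* (Begin c, replicate (Suc n) 1) (Seq Spin (Loop 1 Spin), w)"
proof -
  define s where "s = (\<lambda>r::nat. if r = 0 then n else 0)"
  define w where "w = replicate n 1 @ [0::nat]"
  have "holds w s"
    by (auto simp: holds_def w_def s_def count_list_replicate)
  have first: "step (Begin c, replicate (Suc n) 1) (c, w)"
    using step.intros[of "Begin c" 1 "replicate n 1"] by (simp add: w_def)
  have "exec (compile f [0] 1) s (s(1 := y))"
    using assms(1) by (intro correctD[OF correct_compile]) (auto simp: s_def)
  then obtain w1 where w1: "step\<^sup>*\<^sup>* (compile f [0] 1, w) (Skip, w1)" "holds w1 (s(1 := y))"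
    using \<open>holds w s\<close> by (rule steps_exec)
  then have "w1 \<noteq> []" by (simp add: holds_not_Nil)
  then obtain a v where v: "w1 = a # v" by (cases w1) auto
  have va: "holds (v @ [a]) (s(1 := y))"
    using holds_append_commute[of "[a]" v] w1(2) by (simp add: v)
  note first
  also have "step\<^sup>*\<^sup>* (c, w) (Seq Skip (Loop 1 Spin), w1)"
    unfolding c_def by (rule steps_Seq) (rule w1)
  also have "step (Seq Skip (Loop 1 Spin), w1) (Loop 1 Spin, v @ [a])"
    using step.intros[of "Seq Skip (Loop 1 Spin)" a v] by (simp add: v)
  finally have start: "step\<^sup>*\<^sup>* (Begin c, replicate (Suc n) 1) (Loop 1 Spin, v @ [a])" .
  show ?thesis
  proof (cases y)
    case 0
    obtain w2 where w2: "step\<^sup>*\<^sup>* (Loop 1 Spin, v @ [a]) (Skip, w2)" "holds w2 (s(1 := y))"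
      using steps_Loop_exit[OF va, of 1 Spin] 0 by auto
    then have "w2 \<noteq> []" by (simp add: holds_not_Nil)
    with start w2(1) 0 that(1) show ?thesis by (meson rtranclp_trans)
  next
    case (Suc k)
    obtain w2 where w2: "step\<^sup>*\<^sup>* (Loop 1 Spin, v @ [a]) (Seq Spin (Loop 1 Spin), w2)"
      "holds w2 ((s(1 := y))(1 := k))"
      using steps_Loop_iter[OF va, of 1 k Spin] Suc by auto
    then have "w2 \<noteq> []" by (simp add: holds_not_Nil)
    with start w2(1) Suc that(2) show ?thesis by (meson rtranclp_trans zero_less_Suc)
  qed
qed

section \<open>Simulation by a commutative rule\<close>

text \<open>
  A cell consists of its label, the state of the machine after reading the first letter of
  the row, the letter displayed, and the letters still to be appended behind it.
\<close>

type_synonym cell = "nat \<times> com \<times> nat \<times> nat list"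

fun extend :: "cell \<Rightarrow> cell option" where
  "extend (l, q, a, []) = None"
| "extend (l, q, a, b # u) = Some (Suc l mod 3, q, b, u)"

text \<open>
  On the diagonal the first letter of the new row is read.
\<close>

fun turn :: "cell \<Rightarrow> cell option" where
  "turn (l, q, a, u) =
     (if q = Halt then None else Some (0, fst (delta q a), a, snd (delta q a)))"

text \<open>The first cell is the neighbour in the new row, the second the one in the old row. The
  letter of the latter moves one place inwards, state and pending letters of the former move
  outwards.\<close>

fun sweep :: "cell \<Rightarrow> cell \<Rightarrow> cell" where
  "sweep (l, q, a, u) (l', q', a', u') = (Suc l mod 3, q, a', u)"

text \<open>\<open>None\<close> is the white cell beyond the end of a row; next to it pending
  letters are appended. In a run, equal labels meet on the diagonal, where by symmetry the two
  neighbours coincide.\<close>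

fun transition :: "cell option \<Rightarrow> cell option \<Rightarrow> cell option" where
  "transition None None = None"
| "transition None (Some y) = extend y"
| "transition (Some x) None = extend x"
| "transition (Some x) (Some y) =
     (if fst y = (fst x + 2) mod 3 then Some (sweep x y)
      else if fst x = (fst y + 2) mod 3 then Some (sweep y x)
      else if x = y then turn x else None)"

text \<open>Modulo 3 the two label tests exclude each other.\<close>

lemma transition_commute: "transition s t = transition t s"
proof -
  have "\<not> (l = (m + 2) mod 3 \<and> m = (l + 2) mod 3)" for l m :: nat
    by presburger
  then show ?thesis
    by (cases s; cases t) auto
qed

text \<open>\<open>b\<close> is the development decoded into cells, with the constant border cut
  off. The \<open>n + 2\<close> cells of row 1 are the letter read last and the \<open>n + 1\<close>
  letters of the initial queue.\<close>

locale sweeping =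
  fixes b :: "nat \<Rightarrow> nat \<Rightarrow> cell option" and c :: com and n :: nat
  assumes b_commute: "b i j = b j i"
    and b_Suc: "i > 0 \<Longrightarrow> j > 0 \<Longrightarrow> b (Suc i) (Suc j) = transition (b i (Suc j)) (b (Suc i) j)"
    and b_first: "b (Suc k) 1 = (if k < Suc (Suc n) then Some (k mod 3, Begin c, 1, []) else None)"
begin

text \<open>
  Row \<open>j\<close> still displays the letter \<open>x\<close> that has been read last.
\<close>

definition row :: "nat \<Rightarrow> com \<times> nat list \<Rightarrow> bool" where
  "row j = (\<lambda>(q, w). \<exists>x. \<forall>k.
     if k < Suc (length w) then \<exists>u. b (j + k) j = Some (k mod 3, q, (x # w) ! k, u)
     else b (j + k) j = None)"

section \<open>Rows follow the steps of the machine\<close>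

lemma row_first: "row 1 (Begin c, replicate (Suc n) 1)"
proof -
  have "(1 # replicate (Suc n) 1) ! k = (1::nat)" if "k < Suc (Suc n)" for k
    using that by (simp add: nth_Cons' del: replicate_Suc)
  then show ?thesis
    unfolding row_def using b_first
    by (auto intro!: exI[of _ "1::nat"] simp del: replicate_Suc)
qed

text \<open>Induction outwards from the diagonal, where \<open>a\<close> is read: the pending list
  \<open>u\<close> is carried unchanged along \<open>w\<close> and then emptied letter by
  letter.\<close>

lemma row_next:
  assumes row: "row j (q, a # w)" and "j > 0" "q \<noteq> Halt"
  defines "u \<equiv> snd (delta q a)"
  shows "b (Suc j + k) (Suc j) =
    (if k < length (a # w @ u)
     then Some (k mod 3, fst (delta q a), (a # w @ u) ! k, drop (k - length w) u) else None)"
proof -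
  obtain x where x: "\<And>k. if k < Suc (length (a # w))
      then \<exists>u. b (j + k) j = Some (k mod 3, q, (x # a # w) ! k, u) else b (j + k) j = None"
    using row unfolding row_def by blast
  show ?thesis
  proof (induction k)
    case 0
    obtain v where v: "b (Suc j) j = Some (1, q, a, v)"
      using x[of 1] by auto
    have "b (Suc j) (Suc j) = transition (b (Suc j) j) (b (Suc j) j)"
      using b_Suc[of j j] b_commute[of j "Suc j"] \<open>j > 0\<close> by simp
    also have "\<dots> = Some (0, fst (delta q a), a, u)"
      using v \<open>q \<noteq> Halt\<close> by (simp add: u_def)
    finally show ?case by simp
  next
    case (Suc k)
    have rec: "b (Suc j + Suc k) (Suc j) = transition (b (Suc j + k) (Suc j)) (b (j + Suc (Suc k)) j)"
      using b_Suc[of "j + Suc k" j] \<open>j > 0\<close> by simp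
    \<comment> \<open>Positions copied from the old row, positions appended, the first white
      position, and those beyond.\<close>
    consider "Suc k \<le> length w" | "length w \<le> k" "Suc k < length (a # w @ u)"
      | "Suc k = length (a # w @ u)" | "length (a # w @ u) \<le> k"
      by fastforce
    then show ?case
    proof cases
      case 1
      obtain v where "b (j + Suc (Suc k)) j = Some (Suc (Suc k) mod 3, q, w ! k, v)"
        using x[of "Suc (Suc k)"] 1 by auto
      \<comment> \<open>The old row supplies the cell two labels further out, which selects
        \<open>sweep\<close> with the new row as first argument.\<close>
      moreover have "Suc (Suc k) mod 3 = (k mod 3 + 2) mod 3" "Suc (k mod 3) mod 3 = Suc k mod 3"
        by presburger+
      ultimately show ?thesis
        using Suc.IH 1 unfolding rec by (simp add: nth_append)
    next
      case 2
      have "b (j + Suc (Suc k)) j = None"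
        using x[of "Suc (Suc k)"] 2 by simp
      moreover have "k - length w < length u"
        using 2 by simp
      then have "drop (k - length w) u = u ! (k - length w) # drop (Suc k - length w) u"
        using 2 by (simp add: Cons_nth_drop_Suc Suc_diff_le)
      moreover have "Suc (k mod 3) mod 3 = Suc k mod 3"
        by presburger
      ultimately show ?thesis
        using Suc.IH 2 unfolding rec by (simp add: nth_append)
    next
      case 3
      then have "b (j + Suc (Suc k)) j = None" "drop (k - length w) u = []"
        using x[of "Suc (Suc k)"] by simp_all
      then show ?thesis
        using Suc.IH 3 unfolding rec by simp
    next
      case 4
      then have "b (j + Suc (Suc k)) j = None"
        using x[of "Suc (Suc k)"] by simp
      then show ?thesis
        using Suc.IH 4 unfolding rec by simp
    qed
  qed
qed

lemma row_step:
  assumes "row j (q, a # w)" "j > 0" "q \<noteq> Halt"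
  shows "row (Suc j) (fst (delta q a), w @ snd (delta q a))"
  unfolding row_def using row_next[OF assms] by (auto intro!: exI[of _ a])

section \<open>Halting and spinning runs\<close>

definition finite_row :: "nat \<Rightarrow> bool" where
  "finite_row j \<longleftrightarrow> (\<exists>B. \<forall>k\<ge>B. b (j + k) j = None)"

lemma row_finite: "row j (q, w) \<Longrightarrow> finite_row j"
  unfolding row_def finite_row_def by (auto intro!: exI[of _ "Suc (length w)"])

lemma row_steps:
  assumes "step\<^sup>*\<^sup>* (Begin c, replicate (Suc n) 1) (q, w)"
  obtains j where "j > 0" "row j (q, w)" "\<And>i. 0 < i \<Longrightarrow> i \<le> j \<Longrightarrow> finite_row i"
proof -
  have "\<exists>j>0. row j (q, w) \<and> (\<forall>i. 0 < i \<and> i \<le> j \<longrightarrow> finite_row i)"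
    using assms
  proof (induction rule: rtranclp_induct2)
    case refl
    show ?case
      using row_first row_finite[OF row_first]
      by (intro exI[of _ 1]) (metis le_less_Suc_eq less_Suc_eq_0_disj One_nat_def Suc_leI le_antisym)
  next
    case (step q w q' w')
    then obtain j where j: "j > 0" "row j (q, w)" "\<forall>i. 0 < i \<and> i \<le> j \<longrightarrow> finite_row i"
      by blast
    from step.hyps(2) have "row (Suc j) (q', w')"
    proof cases
      case (1 a v)
      then show ?thesis
        using row_step[of j q a v] j by simp
    qed
    with j row_finite show ?case
      by (intro exI[of _ "Suc j"]) (auto simp: le_Suc_eq)
  qed
  with that show ?thesis by blast
qed

text \<open>From \<open>Skip\<close> the machine enters \<open>Halt\<close> with nothing to append.
  The next diagonal cell is therefore \<open>None\<close>, nothing extends into its row, and all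
  later rows stay white. The finitely many rows before are finite each, which bounds
  \<open>i + j\<close>.\<close>

lemma dies_if_halts:
  assumes "step\<^sup>*\<^sup>* (Begin c, replicate (Suc n) 1) (Skip, w)" "w \<noteq> []"
  shows "\<exists>N. \<forall>i j. i > 0 \<and> j > 0 \<and> i + j > N \<longrightarrow> b i j = None"
proof -
  from assms(1) obtain j where j: "j > 0" "row j (Skip, w)" "\<And>i. 0 < i \<Longrightarrow> i \<le> j \<Longrightarrow> finite_row i"
    by (rule row_steps) blast
  obtain a v where w: "w = a # v"
    using assms(2) by (cases w) auto
  have halt: "b (Suc j + k) (Suc j) =
      (if k < Suc (length v) then Some (k mod 3, Halt, w ! k, []) else None)" for k
    using row_next[of j Skip a v k] j by (simp add: w)
  have dead: "b (j + 2 + m + k) (j + 2 + m) = None" for m k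
  proof (induction m arbitrary: k)
    case 0
    show ?case
    proof (induction k)
      case 0
      have "b (Suc (Suc j)) (Suc (Suc j)) =
          transition (b (Suc (Suc j)) (Suc j)) (b (Suc (Suc j)) (Suc j))"
        using b_Suc[of "Suc j" "Suc j"] b_commute[of "Suc j" "Suc (Suc j)"] by simp
      also have "\<dots> = None"
        using halt[of 1] by simp
      finally show ?case by simp
    next
      case (Suc k)
      have "b (j + 2 + 0 + Suc k) (j + 2 + 0) =
          transition (b (j + 2 + 0 + k) (j + 2 + 0)) (b (Suc j + Suc (Suc k)) (Suc j))"
        using b_Suc[of "Suc (Suc j) + k" "Suc j"] by simp
      then show ?case
        unfolding Suc halt by simp
    qed
  next
    case (Suc m)
    note above = Suc
    show ?case
    proof (induction k)
      case 0
      have "b (j + 2 + Suc m) (j + 2 + Suc m) =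
          transition (b (j + 2 + m + 1) (j + 2 + m)) (b (j + 2 + m + 1) (j + 2 + m))"
        using b_Suc[of "j + 2 + m" "j + 2 + m"] b_commute[of "j + 2 + m" "j + 2 + Suc m"] by simp
      then show ?case
        unfolding above by simp
    next
      case (Suc k)
      have "b (j + 2 + Suc m + Suc k) (j + 2 + Suc m) =
          transition (b (j + 2 + Suc m + k) (j + 2 + Suc m)) (b (j + 2 + m + Suc (Suc k)) (j + 2 + m))"
        using b_Suc[of "j + 2 + Suc m + k" "j + 2 + m"] by simp
      then show ?case
        unfolding above Suc by simp
    qed
  qed
  have "finite_row (Suc j)"
    using halt unfolding finite_row_def by (auto intro!: exI[of _ "Suc (length v)"])
  then have "finite_row i" if "i \<in> {1..Suc j}" for i
    using that j(3)[of i] by (cases "i = Suc j") auto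
  then have "\<forall>i\<in>{1..Suc j}. \<exists>B. \<forall>k\<ge>B. b (i + k) i = None"
    unfolding finite_row_def by blast
  then obtain B where B: "\<And>i k. i \<in> {1..Suc j} \<Longrightarrow> B i \<le> k \<Longrightarrow> b (i + k) i = None"
    by metis
  define M where "M = Max (B ` {1..Suc j})"
  have M: "B i \<le> M" if "i \<in> {1..Suc j}" for i
    unfolding M_def using that by (intro Max_ge) auto
  \<comment> \<open>The summand \<open>2 * Suc j\<close> makes up for the difference
    \<open>2 * l\<close> between \<open>i + l\<close> and \<open>i - l\<close>.\<close>
  have none: "b i l = None" if "l > 0" "l \<le> i" "i + l > 2 * Suc j + M" for i l
  proof (cases "l \<le> Suc j")
    case True
    have "b (l + (i - l)) l = None"
      using that True M[of l] by (intro B) auto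
    with that show ?thesis by simp
  next
    case False
    then have "j + 2 + (l - (j + 2)) + (i - l) = i" "j + 2 + (l - (j + 2)) = l"
      using that by simp_all
    with dead[of "l - (j + 2)" "i - l"] show ?thesis
      by (simp only:)
  qed
  have "b i l = None" if "i > 0" "l > 0" "i + l > 2 * Suc j + M" for i l
    using none[of l i] none[of i l] b_commute[of i l] that by (cases "l \<le> i") (simp_all add: add.commute)
  then show ?thesis by blast
qed

text \<open>A spinning machine only rotates its queue, so no later row becomes empty, and every row
  starts on the diagonal.\<close>

lemma survives_if_spins:
  assumes "step\<^sup>*\<^sup>* (Begin c, replicate (Suc n) 1) (q, w)" "w \<noteq> []" "q \<noteq> Halt"
    and spin: "\<And>a. delta q a = (q, [a])"
  shows "\<exists>j>0. \<forall>i\<ge>j. b i i \<noteq> None"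
proof -
  from assms(1) obtain j where j: "j > 0" "row j (q, w)"
    by (rule row_steps) blast
  have rows: "\<exists>v. v \<noteq> [] \<and> row (j + m) (q, v)" for m
  proof (induction m)
    case 0
    then show ?case using j assms(2) by auto
  next
    case (Suc m)
    then obtain a v where "row (j + m) (q, a # v)"
      by (metis neq_Nil_conv)
    then have "row (Suc (j + m)) (q, v @ [a])"
      using row_step[of "j + m" q a v] j(1) assms(3) by (simp add: spin)
    then show ?case by auto
  qed
  have "b i i \<noteq> None" if "i \<ge> j" for i
  proof -
    obtain v where "row (j + (i - j)) (q, v)"
      using rows by blast
    with that have "row i (q, v)" by simp
    then obtain x where "\<forall>k. if k < Suc (length v)
        then \<exists>u. b (i + k) i = Some (k mod 3, q, (x # v) ! k, u) else b (i + k) i = None"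
      unfolding row_def by blast
    from spec[OF this, of 0] show ?thesis by auto
  qed
  with j(1) show ?thesis by blast
qed

end

section \<open>Finiteness of the rule\<close>

text \<open>A finite set of states closed under \<open>delta\<close>, similar to the partial
  derivatives of a regular expression: a loop body returns to the same loop, so the nesting of
  \<open>Seq\<close> stays bounded.\<close>

fun reach :: "com \<Rightarrow> com set" where
  "reach Skip = {Skip, Halt}"
| "reach Halt = {Halt}"
| "reach Spin = {Spin}"
| "reach (Inc r) = {Inc r, Skip, Halt}"
| "reach (Seq c c') = (\<lambda>d. Seq d c') ` reach c \<union> reach c'"
| "reach (Loop r b) = {Loop r b, Loop2 r b, Skip, Halt} \<union> (\<lambda>d. Seq d (Loop r b)) ` reach b"
| "reach (Loop2 r b) = {Loop r b, Loop2 r b, Skip, Halt} \<union> (\<lambda>d. Seq d (Loop r b)) ` reach b"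
| "reach (Begin c) = insert (Begin c) (reach c)"

fun regs :: "com \<Rightarrow> nat set" where
  "regs (Inc r) = {r}"
| "regs (Seq c c') = regs c \<union> regs c'"
| "regs (Loop r b) = insert r (regs b)"
| "regs (Loop2 r b) = insert r (regs b)"
| "regs (Begin c) = regs c"
| "regs _ = {}"

lemma finite_reach: "finite (reach c)"
  by (induction c) auto

lemma finite_regs: "finite (regs c)"
  by (induction c) auto

lemma reach_refl: "c \<in> reach c"
  by (induction c) auto

lemma delta_in_reach: "d \<in> reach c \<Longrightarrow> fst (delta d a) \<in> reach c"
  by (induction c arbitrary: d) (auto simp: reach_refl if_distrib[of fst] split: if_splits)

lemma regs_reach: "d \<in> reach c \<Longrightarrow> regs d \<subseteq> regs c"
proof (induction c arbitrary: d)
  case (Seq c c')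
  then show ?case by fastforce
next
  case (Loop r b)
  then show ?case by fastforce
next
  case (Loop2 r b)
  then show ?case by fastforce
qed auto

lemma set_snd_delta: "set (snd (delta d a)) \<subseteq> insert a (insert 0 (Suc ` regs d))"
  by (induction d) auto

lemma length_snd_delta: "length (snd (delta d a)) \<le> 2"
  by (induction d) auto

definition cells :: "com \<Rightarrow> cell set" where
  "cells c = (let L = insert 0 (insert 1 (Suc ` regs c)) in
     {..<3} \<times> reach (Begin c) \<times> L \<times> {u. set u \<subseteq> L \<and> length u \<le> 2})"

lemma finite_cells: "finite (cells c)"
  unfolding cells_def Let_def
  by (intro finite_cartesian_product finite_lists_length_le) (simp_all add: finite_reach finite_regs)

lemma first_in_cells: "l < 3 \<Longrightarrow> (l, Begin c, 1, []) \<in> cells c"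
  by (auto simp: cells_def Let_def)

lemma turn_in_cells:
  assumes "x \<in> cells c" "turn x = Some y"
  shows "y \<in> cells c"
proof -
  obtain l q a u where x: "x = (l, q, a, u)" by (cases x)
  have q: "q \<in> reach (Begin c)" and a: "a \<in> insert 0 (insert 1 (Suc ` regs c))"
    using assms(1) by (auto simp: x cells_def Let_def)
  have "set (snd (delta q a)) \<subseteq> insert 0 (insert 1 (Suc ` regs c))"
    using set_snd_delta[of q a] regs_reach[OF q] a by auto
  moreover have y: "y = (0, fst (delta q a), a, snd (delta q a))"
    using assms(2) by (auto simp: x split: if_splits)
  ultimately show ?thesis
    unfolding y cells_def Let_def using a delta_in_reach[OF q] length_snd_delta[of q a] by simp
qed

lemma extend_in_cells: "x \<in> cells c \<Longrightarrow> extend x = Some y \<Longrightarrow> y \<in> cells c"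
  by (cases x rule: extend.cases) (auto simp: cells_def Let_def)

lemma sweep_in_cells: "x \<in> cells c \<Longrightarrow> y \<in> cells c \<Longrightarrow> sweep x y \<in> cells c"
  by (cases x; cases y) (auto simp: cells_def Let_def)

definition cell_states :: "com \<Rightarrow> cell option set" where
  "cell_states c = insert None (Some ` cells c)"

lemma transition_in_cell_states:
  assumes "s \<in> cell_states c" "t \<in> cell_states c"
  shows "transition s t \<in> cell_states c"
proof (cases "transition s t")
  case (Some y)
  with assms have "y \<in> cells c"
    by (cases s; cases t)
      (auto simp: cell_states_def intro: extend_in_cells turn_in_cells sweep_in_cells split: if_splits)
  with Some show ?thesis by (simp add: cell_states_def)
qed (simp add: cell_states_def)

section \<open>Undecidability\<close>

text \<open>White must be 0, 1 is left to the border, 2 to 4 are the initial cells as expected by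
  \<open>view\<close>; the remaining codes start at 5.\<close>

definition cell_code :: "com \<Rightarrow> cell option \<Rightarrow> nat" where
  "cell_code c s = (case s of None \<Rightarrow> 0
     | Some x \<Rightarrow> if fst x < 3 \<and> snd x = (Begin c, 1, []) then 2 + fst x else 5 + to_nat x)"

lemma inj_cell_code: "inj (cell_code c)"
proof (rule injI)
  fix s t assume "cell_code c s = cell_code c t"
  then show "s = t"
    by (cases s; cases t) (auto simp: cell_code_def prod_eq_iff split: if_splits)
qed

lemma cell_code_None: "cell_code c None = 0"
  and cell_code_neq_1: "cell_code c s \<noteq> 1"
  and cell_code_first: "l < 3 \<Longrightarrow> cell_code c (Some (l, Begin c, 1, [])) = 2 + l"
  by (auto simp: cell_code_def split: option.splits)

lemma first_in_cell_states: "l < 3 \<Longrightarrow> Some (l, Begin c, 1, []) \<in> cell_states c"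
  unfolding cell_states_def by (intro insertI2 imageI first_in_cells)

section \<open>The number of a transition table\<close>

definition rule_graph :: "com \<Rightarrow> nat set" where
  "rule_graph c = (\<lambda>(s, t). prod_encode (cell_code c s,
     prod_encode (cell_code c t, cell_code c (transition s t)))) ` (cell_states c \<times> cell_states c)"

definition rule_number :: "com \<Rightarrow> nat" where
  "rule_number c = set_encode (rule_graph c)"

lemma finite_rule_graph: "finite (rule_graph c)"
  by (simp add: rule_graph_def cell_states_def finite_cells)

lemma in_rule_graph_iff:
  "prod_encode (x, prod_encode (y, z)) \<in> rule_graph c \<longleftrightarrow>
     (\<exists>s\<in>cell_states c. \<exists>t\<in>cell_states c.
       x = cell_code c s \<and> y = cell_code c t \<and> z = cell_code c (transition s t))"
  by (auto simp: rule_graph_def prod_encode_eq) blast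

lemma lookup_rule_number:
  "lookup (rule_number c) x y =
     (\<Sum>z<rule_number c. z * of_bool (prod_encode (x, prod_encode (y, z)) \<in> rule_graph c))"
proof -
  have "odd (rule_number c div 2 ^ m) \<longleftrightarrow> m \<in> rule_graph c" for m
    using set_encode_inverse[OF finite_rule_graph[of c]]
    unfolding rule_number_def set_decode_def by blast
  then show ?thesis
    by (simp add: lookup_def mod_2_eq_odd)
qed

text \<open>A symmetric polynomial requires this also for numbers that code no cell; the symmetry of
  the graph itself provides it.\<close>

lemma lookup_commute: "lookup (rule_number c) x y = lookup (rule_number c) y x"
proof -
  have "prod_encode (x, prod_encode (y, z)) \<in> rule_graph c \<longleftrightarrow>
      prod_encode (y, prod_encode (x, z)) \<in> rule_graph c" for z
    unfolding in_rule_graph_iff using transition_commute by metis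
  then show ?thesis
    by (simp add: lookup_rule_number)
qed

text \<open>An element \<open>m\<close> of the coded set gives
  \<open>2 ^ m \<le> rule_number c\<close>, and \<open>m\<close> bounds the codes inside it. Hence
  the elements from \<open>d\<close> on do not clash with codes, and the range \<open>z < d\<close>
  in \<open>lookup\<close> contains every value.\<close>

lemma cell_code_less:
  assumes "s \<in> cell_states c"
  shows "cell_code c s < rule_number c"
proof -
  let ?m = "prod_encode (cell_code c s, prod_encode (cell_code c s, cell_code c (transition s s)))"
  have "?m \<in> rule_graph c"
    using assms in_rule_graph_iff by blast
  then have "2 ^ ?m \<le> rule_number c"
    unfolding rule_number_def set_encode_def
    by (intro member_le_sum) (auto simp: finite_rule_graph)
  moreover have "cell_code c s \<le> ?m"
    by (rule le_prod_encode_1)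
  moreover have "?m < 2 ^ ?m"
    by (rule less_exp)
  ultimately show ?thesis by linarith
qed

lemma lookup_cell_code:
  assumes "s \<in> cell_states c" "t \<in> cell_states c"
  shows "lookup (rule_number c) (cell_code c s) (cell_code c t) = cell_code c (transition s t)"
proof -
  have "prod_encode (cell_code c s, prod_encode (cell_code c t, z)) \<in> rule_graph c \<longleftrightarrow>
      z = cell_code c (transition s t)" for z
    unfolding in_rule_graph_iff using assms injD[OF inj_cell_code] by metis
  then have "lookup (rule_number c) (cell_code c s) (cell_code c t) =
      (\<Sum>z<rule_number c. if z = cell_code c (transition s t) then z else 0)"
    unfolding lookup_rule_number by (intro sum.cong) auto
  also have "\<dots> = cell_code c (transition s t)"
    using cell_code_less[OF transition_in_cell_states[OF assms]] by simp
  finally show ?thesis .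
qed

lemma local_rule_commute: "local_rule (rule_number c) x y = local_rule (rule_number c) y x"
  by (auto simp: local_rule_def lookup_commute)

text \<open>Here the self-reference arises: \<open>d\<close> codes the table of \<open>c\<close> and
  also fixes the length of the initial queue, so \<open>c\<close> runs on its own number.\<close>

lemma ultimately_zero_iff:
  fixes f :: recf and y :: nat
  defines "c \<equiv> Seq (compile f [0] 1) (Loop 1 Spin)"
  defines "d \<equiv> rule_number c"
  assumes f: "computes f [d] y"
  shows "ultimately_zero (instance_system (prime_instance (modulus d) (local_rule d))) \<longleftrightarrow> y = 0"
proof -
  define p where "p = modulus d"
  interpret prime_presentation p "local_rule d"
    using modulus(1) by unfold_locales (simp add: p_def)
  have p: "2 * d + 6 \<le> p"
    using modulus(2) by (simp add: p_def)
  \<comment> \<open>The initial cell has code 2 and lies below \<open>d\<close>, so the counting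
    elements avoid 0 and 1.\<close>
  have "cell_code c (Some (0, Begin c, 1, [])) < d"
    unfolding d_def by (intro cell_code_less first_in_cell_states) simp
  then have d: "d > 2"
    by (simp add: cell_code_first del: One_nat_def)
  define a where "a = development (instance_system (prime_instance p (local_rule d)))"
  have a_0: "a 0 j = 1" "a i 0 = 1" for i j
    unfolding a_def by (rule development_boundary)+
  have a_Suc: "a (Suc i) (Suc j) = local_rule d (a i (Suc j)) (a (Suc i) j) mod p" for i j
    unfolding a_def by (rule development_Suc)
  have a_commute: "a i j = a j i" for i j
  proof (induction "i + j" arbitrary: i j rule: less_induct)
    case less
    show ?case
    proof (cases i; cases j)
      fix i' j' assume ij: "i = Suc i'" "j = Suc j'"
      have "a i' (Suc j') = a (Suc j') i'" "a (Suc i') j' = a j' (Suc i')"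
        by (intro less; simp add: ij)+
      then show ?thesis
        unfolding ij a_Suc using local_rule_commute by (simp add: d_def)
    qed (simp_all add: a_0)
  qed
  have a_first: "a (Suc k) 1 = (if k < Suc (Suc d) then d + k else 0)" for k
  proof (induction k)
    case 0
    show ?case
      using a_Suc[of 0 0] p by (simp add: a_0 local_rule_def)
  next
    case (Suc k)
    have "a (Suc (Suc k)) 1 = local_rule d (a (Suc k) 1) 1 mod p"
      using a_Suc[of "Suc k" 0] by (simp add: a_0)
    then show ?case
      unfolding Suc using d p by (auto simp: local_rule_def)
  qed
  \<comment> \<open>Decoding: \<open>cell_of\<close> inverts the numbering after
    \<open>view\<close>; the \<open>represented\<close> elements are those that stand for a cell
    state.\<close>
  define cell_of where "cell_of = (\<lambda>x. inv_into UNIV (cell_code c) (view d x))"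
  define represented where "represented = (\<lambda>x. x \<noteq> 1 \<and> view d x \<in> cell_code c ` cell_states c)"
  have code_cell_of: "cell_code c (cell_of x) = view d x" "cell_of x \<in> cell_states c"
    if "represented x" for x
    using that inj_cell_code[of c] by (auto simp: represented_def cell_of_def)
  have cell_of_eq: "cell_of x = s" if "view d x = cell_code c s" for x s
    using that inj_cell_code[of c] by (simp add: cell_of_def)
  have small: "represented (cell_code c s)" "view d (cell_code c s) = cell_code c s"
    if "s \<in> cell_states c" for s
    using that cell_code_less[OF that] cell_code_neq_1
    by (auto simp: represented_def view_def d_def)
  have rule: "represented (local_rule d x y mod p)"
    "cell_of (local_rule d x y mod p) = transition (cell_of x) (cell_of y)"
    if "represented x" "represented y" for x y
  proof -
    let ?t = "transition (cell_of x) (cell_of y)"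
    have t: "?t \<in> cell_states c"
      using code_cell_of that by (simp add: transition_in_cell_states)
    have "local_rule d x y = lookup d (cell_code c (cell_of x)) (cell_code c (cell_of y))"
      using that code_cell_of by (simp add: local_rule_def represented_def)
    also have "\<dots> = cell_code c ?t"
      unfolding d_def using that code_cell_of(2) by (intro lookup_cell_code)
    finally have "local_rule d x y mod p = cell_code c ?t"
      using cell_code_less[OF t] p by (simp add: d_def)
    then show "represented (local_rule d x y mod p)" "cell_of (local_rule d x y mod p) = ?t"
      using small[OF t] cell_of_eq by simp_all
  qed
  have chain: "represented (d + k)" "cell_of (d + k) = Some (k mod 3, Begin c, 1, [])" for k
  proof -
    have "view d (d + k) = cell_code c (Some (k mod 3, Begin c, 1, []))"
      by (simp add: view_def cell_code_first del: One_nat_def)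
    moreover have "Some (k mod 3, Begin c, 1, []) \<in> cell_states c"
      by (rule first_in_cell_states) simp
    ultimately show "represented (d + k)" "cell_of (d + k) = Some (k mod 3, Begin c, 1, [])"
      using d cell_of_eq by (auto simp: represented_def)
  qed
  have zero: "represented 0" "cell_of 0 = None"
    using small[of None] cell_of_eq[of 0 None] by (simp_all add: cell_states_def cell_code_None)
  \<comment> \<open>Neither the border value 1 nor a number without meaning arises inside, so every
    value there decodes.\<close>
  have a_represented: "represented (a (Suc i) (Suc j))" for i j
  proof (induction "i + j" arbitrary: i j rule: less_induct)
    case less
    have first: "represented (a (Suc k) 1)" for k
      unfolding a_first using chain zero by simp
    show ?case
    proof (cases "i = 0 \<or> j = 0")
      case True
      then show ?thesis
        using first[of i] first[of j] a_commute[of 1 "Suc j"] by auto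
    next
      case False
      then obtain i' j' where "i = Suc i'" "j = Suc j'"
        by (metis not0_implies_Suc)
      then show ?thesis
        unfolding a_Suc[of i j] using less[of i' j] less[of i j'] by (intro rule) simp_all
    qed
  qed
  define b where "b = (\<lambda>i j. cell_of (a i j))"
  have b_commute': "b i j = b j i" for i j
    using a_commute[of i j] by (simp only: b_def)
  have b_Suc': "b (Suc i) (Suc j) = transition (b i (Suc j)) (b (Suc i) j)" if "i > 0" "j > 0" for i j
  proof -
    have "represented (a i (Suc j))" "represented (a (Suc i) j)"
      using a_represented[of "i - 1" j] a_represented[of i "j - 1"] that by simp_all
    from rule(2)[OF this] show ?thesis
      by (simp only: b_def a_Suc[of i j])
  qed
  have b_first': "b (Suc k) 1 = (if k < Suc (Suc d) then Some (k mod 3, Begin c, 1, []) else None)" for k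
    unfolding b_def a_first using chain(2) zero(2) by simp
  interpret sweeping b c d
    by (unfold_locales; fact b_commute' b_Suc' b_first')
  \<comment> \<open>\<open>view\<close> sends only 0 to 0, since elements from \<open>d\<close> on
    have views of at least 2.\<close>
  have b_None: "b i j = None \<longleftrightarrow> a i j = 0" if "i > 0" "j > 0" for i j
  proof
    assume "b i j = None"
    moreover have "represented (a i j)"
      using that a_represented by (metis gr0_implies_Suc)
    ultimately have "view d (a i j) = 0"
      using code_cell_of(1) cell_code_None by (metis b_def)
    then show "a i j = 0"
      by (simp add: view_def split: if_splits)
  qed (simp add: b_def zero)
  have uz: "ultimately_zero (instance_system (prime_instance p (local_rule d))) \<longleftrightarrow>
      (\<exists>N. \<forall>i j. i > 0 \<and> j > 0 \<and> i + j > N \<longrightarrow> b i j = None)"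
    unfolding ultimately_zero_def white_eq a_def[symmetric] using b_None by metis
  from f have "ultimately_zero (instance_system (prime_instance p (local_rule d))) \<longleftrightarrow> y = 0"
  proof (cases rule: steps_recf)
    case (1 w)
    from dies_if_halts[OF 1(3)[folded c_def] 1(1)] 1(2) show ?thesis
      unfolding uz by simp
  next
    case (2 w)
    obtain j where j: "j > 0" "\<And>i. i \<ge> j \<Longrightarrow> b i i \<noteq> None"
      using survives_if_spins[OF 2(3)[folded c_def] 2(1)] by auto
    have "\<not> (\<forall>i l. i > 0 \<and> l > 0 \<and> i + l > N \<longrightarrow> b i l = None)" for N
      using j(1) j(2)[of "j + N"] by (metis add_gr_0 le_add1 less_add_same_cancel2 trans_less_add2)
    with 2(2) show ?thesis
      unfolding uz by simp
  qed
  then show ?thesis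
    by (simp only: p_def)
qed

theorem corollary1p6:
  shows "\<not> decidable_on instance_encode {I. valid_instance I}
             (\<lambda>I. ultimately_zero (instance_system I)) \<and>
         \<not> decidable_on instance_encode
             {I. valid_instance I \<and> prime_field (presented_ring I) \<and>
                 symmetric_poly (presented_poly I)}
             (\<lambda>I. ultimately_zero (instance_system I))"
proof -
  let ?D = "{I. valid_instance I \<and> prime_field (presented_ring I) \<and> symmetric_poly (presented_poly I)}"
  have main: "\<not> decidable_on instance_encode ?D (\<lambda>I. ultimately_zero (instance_system I))"
  proof
    assume "decidable_on instance_encode ?D (\<lambda>I. ultimately_zero (instance_system I))"
    then obtain P where P: "\<And>I. I \<in> ?D \<Longrightarrow>
        computes P [instance_encode I] (if ultimately_zero (instance_system I) then 1 else 0)"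
      unfolding decidable_on_def by blast
    obtain G where G: "\<And>e. computes G (map e [0..<1])
        (instance_encode (prime_instance (modulus (e 0)) (local_rule (e 0))))"
      using recursive_prime_instance unfolding recursive_def by blast
    \<comment> \<open>The diagonal program: \<open>G\<close> builds the instance from
      \<open>d\<close>, \<open>P\<close> judges it, and \<open>c\<close> halts on the verdict 0 and
      spins on 1.\<close>
    define c where "c = Seq (compile (Comp P [G]) [0] 1) (Loop 1 Spin)"
    define d where "d = rule_number c"
    define I where "I = prime_instance (modulus d) (local_rule d)"
    interpret prime_presentation "modulus d" "local_rule d"
      using modulus(1) by unfold_locales
    have "I \<in> ?D"
      using valid prime_field_R symmetric local_rule_commute by (simp add: I_def d_def)
    then have "computes P [instance_encode I] (if ultimately_zero (instance_system I) then 1 else 0)"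
      by (rule P)
    moreover have "computes G [d] (instance_encode I)"
      using G[of "\<lambda>_. d"] by (simp add: I_def)
    ultimately have "computes (Comp P [G]) [d] (if ultimately_zero (instance_system I) then 1 else 0)"
      by (intro computes.Comp[where ys = "[instance_encode I]"]) simp_all
    \<comment> \<open>The system is ultimately zero iff the verdict is 0, that is, iff
      \<open>P\<close> denies it.\<close>
    then have "ultimately_zero (instance_system I) \<longleftrightarrow>
        (if ultimately_zero (instance_system I) then 1 else 0) = (0::nat)"
      unfolding I_def d_def c_def by (rule ultimately_zero_iff)
    then show False
      by (simp split: if_splits)
  qed
  \<comment> \<open>A program that is right on all valid instances is right on the restricted
    ones.\<close>
  moreover have "decidable_on instance_encode ?D (\<lambda>I. ultimately_zero (instance_system I))"
    if "decidable_on instance_encode {I. valid_instance I} (\<lambda>I. ultimately_zero (instance_system I))"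
    using that unfolding decidable_on_def by blast
  ultimately show ?thesis by blast
qed

end
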